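(* Let $\mathbf{k}$ be an algebraically closed field of any characteristic. Consider the following eleven families of affine linear systems of affine spaces $\mathbb{A}^3\to\mathbb{A}^n$: (1) ($n=1$) $x+r_2(y,z)+r_3(y,z)$ where $r_i\in\mathbf{k}[y,z]$ is homogeneous of degree $i$; (2) ($n=1$) $xy+yr_2(y,z)+z$ where $r_2\in\mathbf{k}[y,z]\setminus\mathbf{k}[y]$ is homogeneous of degree $2$; (3) ($n=1$) $xy^2+y(z^2+az+b)+z$ where $a,b\in\mathbf{k}$; (4) ($n=2$) $(x+p_2(y,z)+p_3(y,z),\ y+q_2z^2+q_3z^3)$ where $p_i\in\mathbf{k}[y,z]$ is homogeneous of degree $i$ and $q_2,q_3\in\mathbf{k}$; (5) ($n=2$) $(yz+za_2(x,z)+x,\ y+a_2(x,z)+r_1z+r_2z^2+r_3z^3)$ where $a_2\in\mathbf{k}[x,z]\setminus\mathbf{k}[z]$ is homogeneous of degree $2$ and $r_1,r_2,r_3\in\mathbf{k}$; (6) ($n=2$) $(yz+za_2(x,z)+x,\ z)$ where $a_2\in\mathbf{k}[x,z]\setminus\mathbf{k}[z]$ is homogeneous of degree $2$; (7) ($n=2$) $(xy^2+y(z^2+az+b)+z,\ y)$ where $a,b\in\mathbf{k}$; (8) ($n=2$) $(x+z^2+y^3,\ y+x^2)$ where $\operatorname{char}(\mathbf{k})=2$; (9) ($n=2$) $(x+z^2+y^3,\ z+x^3)$ where $\operatorname{char}(\mathbf{k})=3$; (10) ($n=3$) $(x+p_2(y,z)+p_3(y,z),\ y+q_2z^2+q_3z^3,\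 z)$ where $p_i\in\mathbf{k}[y,z]$ is homogeneous of degree $i$ and $q_2,q_3\in\mathbf{k}$; (11) ($n=3$) $(yz+za_2(x,z)+x,\ y+a_2(x,z)+r_2z^2+r_3z^3,\ z)$ where $a_2\in\mathbf{k}[x,z]\setminus\mathbf{k}[z]$ is homogeneous of degree $2$ and $r_2,r_3\in\mathbf{k}$. These eleven families define disjoint sets of equivalence classes of affine linear systems of affine spaces; that is, if $k,l\in\{1,\dots,11\}$ and $f,g\colon\mathbb{A}^3\to\mathbb{A}^n$ are equivalent affine linear systems of affine spaces belonging to family $(k)$ and family $(l)$, respectively, then $k=l$.
   Context: $\mathbb{A}^3=\operatorname{Spec}(\mathbf{k}[x,y,z])$. A morphism $f=(f_1,\dots,f_n)\colon\mathbb{A}^d\to\mathbb{A}^n$ is an affine linear system of affine spaces if for each $\lambda_0\in\mathbf{k}$ and each $(\lambda_1,\dots,\lambda_n)\in\mathbf{k}^n\setminus\{0\}$ the polynomial $\lambda_0+\lambda_1f_1+\dots+\lambda_nf_n$ is not constant and the hypersurface (scheme) it defines in $\mathbb{A}^d$ is isomorphic to $\mathbb{A}^{d-1}$. Two affine linear systems of affine spaces $f,g\colon\mathbb{A}^d\to\mathbb{A}^n$ are equivalent if $f=\alpha\circ g\circ\beta$ for some affine automorphisms (automorphisms of degree $1$) $\alpha$ of $\mathbb{A}^n$ and $\beta$ of $\mathbb{A}^d$. By convention the zero polynomial is homogeneous of any degree. *)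

theory Defs
  imports
    "HOL-Library.Poly_Mapping"
    "HOL-Computational_Algebra.Polynomial"
    "HOL-Algebra.QuotRing"
begin

section \<open>Multivariate polynomials\<close>

text \<open>
  A monomial is a finitely supported exponent vector and a polynomial is a finitely supported
  family of coefficients indexed by monomials; the variables are indexed by the natural numbers.
  The polynomials in the variables with index in \<open>V\<close> are singled out by \<open>polys_in V\<close>,
  so that the ring of regular functions on affine \<open>d\<close>-space is \<open>polys_in {..<d}\<close>.
\<close>

type_synonym 'a mpoly = "(nat \<Rightarrow>\<^sub>0 nat) \<Rightarrow>\<^sub>0 'a"

definition Const :: "'a::zero \<Rightarrow> 'a mpoly"
  where "Const c = Poly_Mapping.single 0 c"

definition Var :: "nat \<Rightarrow> 'a::zero_neq_one mpoly"
  where "Var i = Poly_Mapping.single (Poly_Mapping.single i 1) 1"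

definition polys_in :: "nat set \<Rightarrow> 'a::zero mpoly set"
  where "polys_in V = {p. \<forall>m\<in>Poly_Mapping.keys p. Poly_Mapping.keys m \<subseteq> V}"

definition monom_degree :: "(nat \<Rightarrow>\<^sub>0 nat) \<Rightarrow> nat"
  where "monom_degree m = (\<Sum>i\<in>Poly_Mapping.keys m. Poly_Mapping.lookup m i)"

definition total_degree :: "'a::zero mpoly \<Rightarrow> nat"
  where "total_degree p = Max (insert 0 (monom_degree ` Poly_Mapping.keys p))"

text \<open>The zero polynomial is homogeneous of every degree.\<close>

definition homogeneous :: "nat \<Rightarrow> 'a::zero mpoly \<Rightarrow> bool"
  where "homogeneous k p \<longleftrightarrow> (\<forall>m\<in>Poly_Mapping.keys p. monom_degree m = k)"

definition subst :: "(nat \<Rightarrow> 'a::comm_ring_1 mpoly) \<Rightarrow> 'a mpoly \<Rightarrow> 'a mpoly"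
  where "subst s p =
    (\<Sum>m\<in>Poly_Mapping.keys p. Const (Poly_Mapping.lookup p m) *
       (\<Prod>i\<in>Poly_Mapping.keys m. s i ^ Poly_Mapping.lookup m i))"


section \<open>Morphisms between affine spaces and their affine automorphisms\<close>

text \<open>A morphism from affine \<open>d\<close>-space to affine \<open>n\<close>-space is the list of its \<open>n\<close> components.\<close>

definition morphism :: "nat \<Rightarrow> nat \<Rightarrow> 'a::zero mpoly list \<Rightarrow> bool"
  where "morphism d n f \<longleftrightarrow> length f = n \<and> set f \<subseteq> polys_in {..<d}"

definition morphism_comp :: "'a::comm_ring_1 mpoly list \<Rightarrow> 'a mpoly list \<Rightarrow> 'a mpoly list"
  where "morphism_comp g f = List.map (subst (\<lambda>i. f ! i)) g"

definition identity :: "nat \<Rightarrow> 'a::comm_ring_1 mpoly list"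
  where "identity n = List.map Var [0..<n]"

definition automorphism :: "nat \<Rightarrow> 'a::comm_ring_1 mpoly list \<Rightarrow> bool"
  where "automorphism n f \<longleftrightarrow> morphism n n f \<and>
    (\<exists>g. morphism n n g \<and> morphism_comp f g = identity n \<and> morphism_comp g f = identity n)"

definition morphism_degree :: "'a::zero mpoly list \<Rightarrow> nat"
  where "morphism_degree f = Max (insert 0 (total_degree ` set f))"

definition affine_automorphism :: "nat \<Rightarrow> 'a::comm_ring_1 mpoly list \<Rightarrow> bool"
  where "affine_automorphism n f \<longleftrightarrow> automorphism n f \<and> morphism_degree f = 1"

definition equivalent_systems :: "nat \<Rightarrow> nat \<Rightarrow> 'a::comm_ring_1 mpoly list \<Rightarrow> 'a mpoly list \<Rightarrow> bool"
  where "equivalent_systems d n f g \<longleftrightarrow>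
    (\<exists>\<alpha> \<beta>. affine_automorphism n \<alpha> \<and> affine_automorphism d \<beta> \<and> f = morphism_comp \<alpha> (morphism_comp g \<beta>))"


section \<open>Affine linear systems of affine spaces\<close>

definition poly_ring :: "nat \<Rightarrow> 'a::comm_ring_1 mpoly ring"
  where "poly_ring d =
    \<lparr>carrier = polys_in {..<d}, mult = (*), one = 1, zero = 0, add = (+)\<rparr>"

text \<open>
  The algebra structures over the ground field are given by the structure maps \<open>s\<close> and \<open>t\<close>.
\<close>

definition algebra_isomorphic ::
    "('k \<Rightarrow> 'r) \<Rightarrow> 'r ring \<Rightarrow> ('k \<Rightarrow> 's) \<Rightarrow> 's ring \<Rightarrow> bool"
  where "algebra_isomorphic s R t S \<longleftrightarrow> (\<exists>h\<in>ring_iso R S. \<forall>c. h (s c) = t c)"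

text \<open>
  The scheme defined by \<open>p\<close> in affine \<open>d\<close>-space is affine with coordinate ring the (possibly
  non-reduced) quotient by the ideal generated by \<open>p\<close>.  Two affine schemes over a field are
  isomorphic iff their coordinate rings are isomorphic as algebras over that field.
\<close>

definition coordinate_ring :: "nat \<Rightarrow> 'a::comm_ring_1 mpoly \<Rightarrow> 'a mpoly set ring"
  where "coordinate_ring d p = poly_ring d Quot (PIdl\<^bsub>poly_ring d\<^esub> p)"

definition coordinate_ring_const :: "nat \<Rightarrow> 'a::comm_ring_1 mpoly \<Rightarrow> 'a \<Rightarrow> 'a mpoly set"
  where "coordinate_ring_const d p c = (PIdl\<^bsub>poly_ring d\<^esub> p) +>\<^bsub>poly_ring d\<^esub> Const c"

definition hypersurface_is_affine_space :: "nat \<Rightarrow> 'a::comm_ring_1 mpoly \<Rightarrow> bool"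
  where "hypersurface_is_affine_space d p \<longleftrightarrow>
    algebra_isomorphic (coordinate_ring_const d p) (coordinate_ring d p)
      Const (poly_ring (d - 1))"

definition affine_linear_system :: "nat \<Rightarrow> nat \<Rightarrow> 'a::field mpoly list \<Rightarrow> bool"
  where "affine_linear_system d n f \<longleftrightarrow> morphism d n f \<and>
    (\<forall>c0. \<forall>c :: nat \<Rightarrow> 'a. (\<exists>i<n. c i \<noteq> 0) \<longrightarrow>
      (let p = Const c0 + (\<Sum>i<n. Const (c i) * f ! i)
       in (\<nexists>e. p = Const e) \<and> hypersurface_is_affine_space d p))"


section \<open>The eleven families\<close>

abbreviation X :: "'a::zero_neq_one mpoly" where "X \<equiv> Var 0"
abbreviation Y :: "'a::zero_neq_one mpoly" where "Y \<equiv> Var 1"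
abbreviation Z :: "'a::zero_neq_one mpoly" where "Z \<equiv> Var 2"

abbreviation k_yz :: "'a::zero mpoly set" where "k_yz \<equiv> polys_in {1, 2}"
abbreviation k_xz :: "'a::zero mpoly set" where "k_xz \<equiv> polys_in {0, 2}"
abbreviation k_y :: "'a::zero mpoly set" where "k_y \<equiv> polys_in {1}"
abbreviation k_z :: "'a::zero mpoly set" where "k_z \<equiv> polys_in {2}"

inductive family :: "nat \<Rightarrow> 'a::field mpoly list \<Rightarrow> bool" where
  fam1: "\<lbrakk>r2 \<in> k_yz; homogeneous 2 r2; r3 \<in> k_yz; homogeneous 3 r3\<rbrakk>
    \<Longrightarrow> family 1 [X + r2 + r3]"
| fam2: "\<lbrakk>r2 \<in> k_yz - k_y; homogeneous 2 r2\<rbrakk>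
    \<Longrightarrow> family 2 [X * Y + Y * r2 + Z]"
| fam3: "family 3 [X * Y^2 + Y * (Z^2 + Const a * Z + Const b) + Z]"
| fam4: "\<lbrakk>p2 \<in> k_yz; homogeneous 2 p2; p3 \<in> k_yz; homogeneous 3 p3\<rbrakk>
    \<Longrightarrow> family 4 [X + p2 + p3, Y + Const q2 * Z^2 + Const q3 * Z^3]"
| fam5: "\<lbrakk>a2 \<in> k_xz - k_z; homogeneous 2 a2\<rbrakk>
    \<Longrightarrow> family 5 [Y * Z + Z * a2 + X,
                  Y + a2 + Const r1 * Z + Const r2 * Z^2 + Const r3 * Z^3]"
| fam6: "\<lbrakk>a2 \<in> k_xz - k_z; homogeneous 2 a2\<rbrakk>
    \<Longrightarrow> family 6 [Y * Z + Z * a2 + X, Z]"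
| fam7: "family 7 [X * Y^2 + Y * (Z^2 + Const a * Z + Const b) + Z, Y]"
| fam8: "CHAR('a) = 2 \<Longrightarrow> family 8 [X + Z^2 + Y^3, Y + X^2]"
| fam9: "CHAR('a) = 3 \<Longrightarrow> family 9 [X + Z^2 + Y^3, Z + X^3]"
| fam10: "\<lbrakk>p2 \<in> k_yz; homogeneous 2 p2; p3 \<in> k_yz; homogeneous 3 p3\<rbrakk>
    \<Longrightarrow> family 10 [X + p2 + p3, Y + Const q2 * Z^2 + Const q3 * Z^3, Z]"
| fam11: "\<lbrakk>a2 \<in> k_xz - k_z; homogeneous 2 a2\<rbrakk>
    \<Longrightarrow> family 11 [Y * Z + Z * a2 + X, Y + a2 + Const r2 * Z^2 + Const r3 * Z^3, Z]"

end

theory Submission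
  imports Defs
begin

text \<open>
  The ground field is infinite, so polynomials may be studied as functions on points.  Equivalent
  systems have the same pencil of functions \<open>c0 + c1 f1 + \<dots> + cn fn\<close> (with some \<open>ci \<noteq> 0\<close>) up
  to an affine change of the source, and the following properties separate the families
  with the same \<open>n\<close>.  Every member \<open>h\<close> of the pencil satisfies \<open>h (p + t v) = h p + t c\<close> for some
  vector \<open>v\<close> and constant \<open>c \<noteq> 0\<close> exactly in families 1, 4, 8, 9, 10.  In families 2 and 6, but not in
  3 and 7, every member satisfies \<open>h (p + t v) = h p + t u p\<close> for some \<open>v \<noteq> 0\<close> and affine \<open>u\<close>.
  The pencils of 6 and 7, but not of 5, have an affine member.  In family 4, but not in 8 and 9, one \<open>v \<noteq> 0\<close>
  serves all members with constant \<open>u\<close>.  Finally 8 and 9 live in different characteristics.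
\<close>

section \<open>Evaluation of polynomials\<close>

definition monom_value :: "(nat \<Rightarrow> 'a::comm_ring_1) \<Rightarrow> (nat \<Rightarrow>\<^sub>0 nat) \<Rightarrow> 'a"
  where "monom_value s m = (\<Prod>i\<in>Poly_Mapping.keys m. s i ^ Poly_Mapping.lookup m i)"

definition eval :: "(nat \<Rightarrow> 'a::comm_ring_1) \<Rightarrow> 'a mpoly \<Rightarrow> 'a"
  where "eval s p = (\<Sum>m\<in>Poly_Mapping.keys p. Poly_Mapping.lookup p m * monom_value s m)"

text \<open>Indices outside the support have exponent 0 and contribute the factor 1, so two
  monomials can be compared over one index set.\<close>

lemma monom_value_superset:
  assumes "finite A" "Poly_Mapping.keys m \<subseteq> A"
  shows "monom_value s m = (\<Prod>i\<in>A. s i ^ Poly_Mapping.lookup m i)"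
  unfolding monom_value_def
  by (rule prod.mono_neutral_left) (use assms in \<open>auto simp: in_keys_iff\<close>)

lemma monom_value_zero [simp]: "monom_value s 0 = 1"
  by (simp add: monom_value_def)

lemma monom_value_add: "monom_value s (m + n) = monom_value s m * monom_value s n"
proof -
  let ?A = "Poly_Mapping.keys m \<union> Poly_Mapping.keys n"
  have "monom_value s (m + n) = (\<Prod>i\<in>?A. s i ^ Poly_Mapping.lookup (m + n) i)"
    using Poly_Mapping.keys_add[of m n] by (intro monom_value_superset) auto
  also have "\<dots> = (\<Prod>i\<in>?A. s i ^ Poly_Mapping.lookup m i) * (\<Prod>i\<in>?A. s i ^ Poly_Mapping.lookup n i)"
    by (simp add: lookup_add power_add prod.distrib)
  also have "\<dots> = monom_value s m * monom_value s n"
    by (simp add: monom_value_superset[of ?A])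
  finally show ?thesis .
qed

lemma eval_superset:
  assumes "finite A" "Poly_Mapping.keys p \<subseteq> A"
  shows "eval s p = (\<Sum>m\<in>A. Poly_Mapping.lookup p m * monom_value s m)"
  unfolding eval_def
  by (rule sum.mono_neutral_left) (use assms in \<open>auto simp: in_keys_iff\<close>)

lemma eval_zero [simp]: "eval s 0 = 0"
  by (simp add: eval_def)

lemma eval_add [simp]: "eval s (p + q) = eval s p + eval s q"
proof -
  let ?A = "Poly_Mapping.keys p \<union> Poly_Mapping.keys q"
  have "eval s (p + q) = (\<Sum>m\<in>?A. Poly_Mapping.lookup (p + q) m * monom_value s m)"
    using Poly_Mapping.keys_add[of p q] by (intro eval_superset) auto
  also have "\<dots> = (\<Sum>m\<in>?A. Poly_Mapping.lookup p m * monom_value s m)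
      + (\<Sum>m\<in>?A. Poly_Mapping.lookup q m * monom_value s m)"
    by (simp add: lookup_add ring_distribs sum.distrib)
  also have "\<dots> = eval s p + eval s q"
    by (simp add: eval_superset[of ?A])
  finally show ?thesis .
qed

lemma eval_sum: "eval s (\<Sum>i\<in>A. f i) = (\<Sum>i\<in>A. eval s (f i))"
  by (induction A rule: infinite_finite_induct) auto

lemma eval_single [simp]: "eval s (Poly_Mapping.single m c) = c * monom_value s m"
  by (simp add: eval_def)

lemma mpoly_eq_sum_single:
  "(p :: 'a::comm_ring_1 mpoly) = (\<Sum>m\<in>Poly_Mapping.keys p. Poly_Mapping.single m (Poly_Mapping.lookup p m))"
  by (rule poly_mapping_eqI) (auto simp: lookup_sum lookup_single when_def in_keys_iff)

lemma eval_mult [simp]: "eval s (p * q) = eval s p * eval s q"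
proof -
  have "p * q = (\<Sum>m\<in>Poly_Mapping.keys p. \<Sum>n\<in>Poly_Mapping.keys q.
      Poly_Mapping.single (m + n) (Poly_Mapping.lookup p m * Poly_Mapping.lookup q n))"
    by (subst mpoly_eq_sum_single[of p], subst mpoly_eq_sum_single[of q])
      (simp add: sum_product mult_single)
  then show ?thesis
    by (simp add: eval_sum monom_value_add eval_def[of s p] eval_def[of s q] sum_product ac_simps)
qed

lemma eval_Const [simp]: "eval s (Const c) = c"
  by (simp add: Const_def)

lemma eval_one [simp]: "eval s 1 = 1"
  using eval_Const[of s 1] by (simp add: Const_def)

lemma eval_Var [simp]: "eval s (Var i) = s i"
  by (simp add: Var_def monom_value_def)

lemma eval_power [simp]: "eval s (p ^ n) = eval s p ^ n"
  by (induction n) auto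

lemma eval_prod: "eval s (\<Prod>i\<in>A. f i) = (\<Prod>i\<in>A. eval s (f i))"
  by (induction A rule: infinite_finite_induct) auto

text \<open>This turns composition of morphisms, defined by substitution, into composition of maps
  on points.\<close>

lemma eval_subst: "eval s (subst \<sigma> p) = eval (\<lambda>i. eval s (\<sigma> i)) p"
  by (simp add: subst_def eval_sum eval_prod eval_def[of "\<lambda>i. eval s (\<sigma> i)"] monom_value_def)

lemma eval_cong:
  assumes "p \<in> polys_in V" "\<And>i. i \<in> V \<Longrightarrow> s i = s' i"
  shows "eval s p = eval s' p"
proof -
  have "monom_value s m = monom_value s' m" if "m \<in> Poly_Mapping.keys p" for m
    unfolding monom_value_def
    by (rule prod.cong) (use assms that in \<open>fastforce simp: polys_in_def\<close>)+
  then show ?thesis by (simp add: eval_def)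
qed

section \<open>Binary quadratic forms\<close>

text \<open>Exponents of two variables that sum to 2 are (2,0), (1,1) or (0,2), so at most three
  coefficients survive.\<close>

lemma homogeneous2_eq:
  fixes p :: "'a::field mpoly"
  assumes "i \<noteq> j" "p \<in> polys_in {i, j}" "homogeneous 2 p"
  obtains a b c where "p = Const a * Var i ^ 2 + Const b * Var i * Var j + Const c * Var j ^ 2"
proof -
  define M where "M = (\<lambda>a b. Poly_Mapping.single i a + Poly_Mapping.single j (b::nat))"
  have keys: "Poly_Mapping.keys p \<subseteq> {M 2 0, M 1 1, M 0 2}"
  proof
    fix m assume m: "m \<in> Poly_Mapping.keys p"
    then have sub: "Poly_Mapping.keys m \<subseteq> {i, j}" and deg: "monom_degree m = 2"
      using assms by (auto simp: polys_in_def homogeneous_def)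
    have "monom_degree m = (\<Sum>i\<in>{i, j}. Poly_Mapping.lookup m i)"
      unfolding monom_degree_def
      by (rule sum.mono_neutral_left) (use sub in \<open>auto simp: in_keys_iff\<close>)
    then have s: "Poly_Mapping.lookup m i + Poly_Mapping.lookup m j = 2"
      using deg assms(1) by simp
    have m_eq: "m = M (Poly_Mapping.lookup m i) (Poly_Mapping.lookup m j)"
      by (rule poly_mapping_eqI)
        (use sub assms(1) in \<open>auto simp: M_def lookup_add lookup_single when_def in_keys_iff\<close>)
    from s consider "Poly_Mapping.lookup m i = 2" "Poly_Mapping.lookup m j = 0"
      | "Poly_Mapping.lookup m i = 1" "Poly_Mapping.lookup m j = 1"
      | "Poly_Mapping.lookup m i = 0" "Poly_Mapping.lookup m j = 2"
      by linarith
    then show "m \<in> {M 2 0, M 1 1, M 0 2}"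
      by cases (use m_eq in auto)
  qed
  \<comment> \<open>The exponent of variable \<open>i\<close> tells the three monomials apart, so
    the sum over the set below splits into three terms.\<close>
  have dist: "M 2 0 \<noteq> M 1 1" "M 2 0 \<noteq> M 0 2" "M 1 1 \<noteq> M 0 2"
    using assms(1) by (auto simp: M_def lookup_add lookup_single when_def
        dest!: arg_cong[where f = "\<lambda>m. Poly_Mapping.lookup m i"])
  have "p = (\<Sum>m\<in>{M 2 0, M 1 1, M 0 2}. Poly_Mapping.single m (Poly_Mapping.lookup p m))"
    by (subst mpoly_eq_sum_single[of p], rule sum.mono_neutral_left)
      (use keys in \<open>auto simp: in_keys_iff\<close>)
  also have "\<dots> = Poly_Mapping.single (M 2 0) (Poly_Mapping.lookup p (M 2 0))
      + Poly_Mapping.single (M 1 1) (Poly_Mapping.lookup p (M 1 1))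
      + Poly_Mapping.single (M 0 2) (Poly_Mapping.lookup p (M 0 2))"
    using dist by (simp add: add.assoc)
  also have "\<dots> = Const (Poly_Mapping.lookup p (M 2 0)) * Var i ^ 2
      + Const (Poly_Mapping.lookup p (M 1 1)) * Var i * Var j
      + Const (Poly_Mapping.lookup p (M 0 2)) * Var j ^ 2"
    by (simp add: Const_def Var_def M_def mult_single power2_eq_square numeral_2_eq_2 flip: single_add)
  finally show ?thesis by (rule that)
qed

lemma Const_mult_Var_power_in_polys_in: "Const c * Var j ^ 2 \<in> polys_in {j}"
  by (auto simp: Const_def Var_def mult_single power2_eq_square polys_in_def in_keys_iff
      simp flip: single_add split: if_splits)

text \<open>If \<open>a\<close> and \<open>b\<close> both vanished, \<open>p\<close> would be a
  multiple of \<open>Var j ^ 2\<close> and lie in \<open>polys_in {j}\<close>. The side conditions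
  of families 2, 5, 6 and 11 enter in this form.\<close>

lemma homogeneous2_eval:
  fixes p :: "'a::field mpoly"
  assumes "i \<noteq> j" "p \<in> polys_in {i, j} - polys_in {j}" "homogeneous 2 p"
  obtains a b c where "\<And>s. eval s p = a * s i ^ 2 + b * s i * s j + c * s j ^ 2" "a \<noteq> 0 \<or> b \<noteq> 0"
proof -
  obtain a b c where p: "p = Const a * Var i ^ 2 + Const b * Var i * Var j + Const c * Var j ^ 2"
    using homogeneous2_eq[of i j p] assms by auto
  have "a \<noteq> 0 \<or> b \<noteq> 0"
  proof (rule ccontr)
    assume "\<not> ?thesis"
    then have "p = Const c * Var j ^ 2" using p by (simp add: Const_def)
    then show False using assms(2) Const_mult_Var_power_in_polys_in[of c j] by simp
  qed
  then show ?thesis using that[of a b c] by (simp add: p)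
qed

section \<open>Affine maps\<close>

text \<open>Coordinates from \<open>d\<close> on are fixed to 0, so equality of points is equality
  of functions on the naturals.\<close>

definition aff_space :: "nat \<Rightarrow> (nat \<Rightarrow> 'a::zero) set"
  where "aff_space d = {p. \<forall>i\<ge>d. p i = 0}"

definition move :: "(nat \<Rightarrow> 'a::comm_ring_1) \<Rightarrow> 'a \<Rightarrow> (nat \<Rightarrow> 'a) \<Rightarrow> nat \<Rightarrow> 'a"
  where "move p t v = (\<lambda>i. p i + t * v i)"

text \<open>The linear part \<open>l\<close> is any function here; its linearity on
  \<open>aff_space d\<close> is a consequence, see
  \<open>affine_functional_linear_part\<close>.\<close>

definition affine_functional :: "nat \<Rightarrow> ((nat \<Rightarrow> 'a::comm_ring_1) \<Rightarrow> 'a) \<Rightarrow> ((nat \<Rightarrow> 'a) \<Rightarrow> 'a) \<Rightarrow> bool"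
  where "affine_functional d u l \<longleftrightarrow>
    (\<forall>p\<in>aff_space d. \<forall>v\<in>aff_space d. \<forall>t. u (move p t v) = u p + t * l v)"

definition affine_map :: "nat \<Rightarrow> ((nat \<Rightarrow> 'a::comm_ring_1) \<Rightarrow> nat \<Rightarrow> 'a) \<Rightarrow> ((nat \<Rightarrow> 'a) \<Rightarrow> nat \<Rightarrow> 'a) \<Rightarrow> bool"
  where "affine_map d B L \<longleftrightarrow> B ` aff_space d \<subseteq> aff_space d \<and> L ` aff_space d \<subseteq> aff_space d \<and>
    (\<forall>p\<in>aff_space d. \<forall>v\<in>aff_space d. \<forall>t. B (move p t v) = move (B p) t (L v))"

definition mutually_inverse_on :: "'b set \<Rightarrow> ('b \<Rightarrow> 'b) \<Rightarrow> ('b \<Rightarrow> 'b) \<Rightarrow> bool"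
  where "mutually_inverse_on S f g \<longleftrightarrow>
    f ` S \<subseteq> S \<and> g ` S \<subseteq> S \<and> (\<forall>x\<in>S. f (g x) = x \<and> g (f x) = x)"

text \<open>\<open>L\<close> and \<open>M\<close> are the linear parts of the mutually inverse affine maps \<open>A\<close> and \<open>B\<close>.\<close>

definition affine_iso where
  "affine_iso d A L B M \<longleftrightarrow> affine_map d A L \<and> affine_map d B M \<and>
    mutually_inverse_on (aff_space d) A B \<and> mutually_inverse_on (aff_space d) L M"

lemma mutually_inverse_on_sym: "mutually_inverse_on S f g \<longleftrightarrow> mutually_inverse_on S g f"
  by (auto simp: mutually_inverse_on_def)

lemma affine_iso_sym: "affine_iso d A L B M \<longleftrightarrow> affine_iso d B M A L"
  by (auto simp: affine_iso_def mutually_inverse_on_sym[of _ A] mutually_inverse_on_sym[of _ L])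

lemma zero_in_aff_space [simp]: "(\<lambda>_. 0) \<in> aff_space d"
  by (simp add: aff_space_def)

lemma move_in_aff_space [simp]: "p \<in> aff_space d \<Longrightarrow> v \<in> aff_space d \<Longrightarrow> move p t v \<in> aff_space d"
  by (simp add: aff_space_def move_def)

lemma move_one_cancel: "move p 1 v = move p 1 w \<longleftrightarrow> v = w"
  by (auto simp: move_def fun_eq_iff)

lemma affine_map_linear_zero:
  assumes "affine_map d B M"
  shows "M (\<lambda>_. 0) = (\<lambda>_. 0)"
proof -
  have "B (\<lambda>_. 0) = B (move (\<lambda>_. 0) 1 (\<lambda>_. 0))" by (simp add: move_def)
  also have "\<dots> = move (B (\<lambda>_. 0)) 1 (M (\<lambda>_. 0))"
    using assms by (simp add: affine_map_def)
  finally show ?thesis by (simp add: move_def fun_eq_iff)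
qed

lemma affine_isoI:
  assumes A: "affine_map d A L" and inv: "mutually_inverse_on (aff_space d) A B"
  obtains M where "affine_iso d A L B M"
proof -
  define o0 :: "nat \<Rightarrow> 'a" where "o0 = (\<lambda>_. 0)"
  \<comment> \<open>\<open>A\<close> sends \<open>w\<close> to \<open>A o0\<close> moved by
    \<open>L w\<close>. Hence \<open>B\<close> sends \<open>A o0\<close> moved by \<open>w\<close>
    to the preimage of \<open>w\<close> under \<open>L\<close>.\<close>
  define M where "M w = B (move (A o0) 1 w)" for w
  have o0: "o0 \<in> aff_space d" by (simp add: o0_def)
  have AS: "\<And>p. p \<in> aff_space d \<Longrightarrow> A p \<in> aff_space d" "\<And>p. p \<in> aff_space d \<Longrightarrow> L p \<in> aff_space d"
    "\<And>p v t. p \<in> aff_space d \<Longrightarrow> v \<in> aff_space d \<Longrightarrow> A (move p t v) = move (A p) t (L v)"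
    using A by (auto simp: affine_map_def)
  have BS: "\<And>p. p \<in> aff_space d \<Longrightarrow> B p \<in> aff_space d"
    "\<And>p. p \<in> aff_space d \<Longrightarrow> A (B p) = p" "\<And>p. p \<in> aff_space d \<Longrightarrow> B (A p) = p"
    using inv by (auto simp: mutually_inverse_on_def)
  have MS: "M w \<in> aff_space d" if "w \<in> aff_space d" for w
    using that by (simp add: M_def BS AS o0)
  have move_o0: "move o0 1 v = v" for v by (simp add: move_def o0_def)
  have L_M: "L (M w) = w" if w: "w \<in> aff_space d" for w
  proof -
    have "move (A o0) 1 (L (M w)) = A (M w)"
      using AS(3)[OF o0 MS[OF w], of 1] by (simp add: move_o0)
    also have "\<dots> = move (A o0) 1 w" using w by (simp add: M_def BS AS o0)
    finally show ?thesis by (simp add: move_one_cancel)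
  qed
  have M_L: "M (L v) = v" if v: "v \<in> aff_space d" for v
    using AS(3)[OF o0 v, of 1] BS(3)[OF v] by (simp add: M_def move_o0)
  have "B (move q t w) = move (B q) t (M w)" if "q \<in> aff_space d" "w \<in> aff_space d" for q t w
  proof -
    have "A (move (B q) t (M w)) = move q t w"
      using that by (simp add: AS BS MS L_M)
    then show ?thesis using BS(3)[of "move (B q) t (M w)"] that by (simp add: BS MS)
  qed
  then have "affine_map d B M"
    using BS MS by (auto simp: affine_map_def)
  moreover have "mutually_inverse_on (aff_space d) L M"
    using AS MS L_M M_L by (auto simp: mutually_inverse_on_def)
  ultimately show ?thesis using A inv by (intro that[of M]) (simp add: affine_iso_def)
qed

definition unit_vec :: "nat \<Rightarrow> nat \<Rightarrow> 'a::zero_neq_one"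
  where "unit_vec i = (\<lambda>_. 0)(i := 1)"

lemma unit_vec_in_aff_space [simp]: "i < d \<Longrightarrow> unit_vec i \<in> aff_space d"
  by (auto simp: aff_space_def unit_vec_def)

text \<open>The point is reached from the origin by switching on one coordinate at a time, a move by
  \<open>q k\<close> along \<open>unit_vec k\<close>.\<close>

lemma affine_functional_coords:
  assumes u: "affine_functional d u l" and q: "q \<in> aff_space d"
  shows "u q = u (\<lambda>_. 0) + (\<Sum>i<d. q i * l (unit_vec i))"
proof -
  have "u (\<lambda>i. if i < k then q i else 0) = u (\<lambda>_. 0) + (\<Sum>i<k. q i * l (unit_vec i))" if "k \<le> d" for k
    using that
  proof (induction k)
    case (Suc k)
    have "(\<lambda>i. if i < Suc k then q i else 0) = move (\<lambda>i. if i < k then q i else 0) (q k) (unit_vec k)"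
      by (auto simp: move_def unit_vec_def less_Suc_eq)
    moreover have "(\<lambda>i. if i < k then q i else 0) \<in> aff_space d"
      using Suc.prems by (auto simp: aff_space_def)
    ultimately show ?case
      using u Suc by (simp add: affine_functional_def add.assoc)
  qed simp
  moreover have "(\<lambda>i. if i < d then q i else 0) = q"
    using q by (auto simp: aff_space_def)
  ultimately show ?thesis by force
qed

lemma affine_functional_linear_part:
  assumes u: "affine_functional d u l" and v: "v \<in> aff_space d"
  shows "l v = (\<Sum>i<d. v i * l (unit_vec i))"
proof -
  have "move (\<lambda>_. 0) 1 v = v" by (simp add: move_def)
  then have "u v = u (\<lambda>_. 0) + l v"
    using u v unfolding affine_functional_def by (metis mult_1 zero_in_aff_space)
  then show ?thesis using affine_functional_coords[OF u v] by simp
qed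

lemma affine_functional_coord_sum:
  assumes "affine_map d A L"
  shows "affine_functional d (\<lambda>q. c0 + (\<Sum>i<d. c i * A q i)) (\<lambda>v. \<Sum>i<d. c i * L v i)"
  using assms
  by (auto simp: affine_functional_def affine_map_def move_def algebra_simps sum.distrib sum_distrib_left)

lemma affine_functional_comp:
  assumes "affine_functional d u l" "affine_map d B L"
  shows "affine_functional d (\<lambda>p. u (B p)) (\<lambda>v. l (L v))"
  using assms by (simp add: affine_functional_def affine_map_def image_subset_iff)

section \<open>Affine automorphisms as maps on points\<close>

definition eval_map :: "'a::comm_ring_1 mpoly list \<Rightarrow> (nat \<Rightarrow> 'a) \<Rightarrow> nat \<Rightarrow> 'a"
  where "eval_map f p = (\<lambda>i. if i < length f then eval p (f ! i) else 0)"

lemma eval_map_in_aff_space: "eval_map f p \<in> aff_space (length f)"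
  by (simp add: eval_map_def aff_space_def)

text \<open>Past index \<open>m\<close> the list entry \<open>f ! j\<close> is unspecified whereas
  \<open>eval_map f p j\<close> is 0. The components of \<open>g\<close> involve only variables
  below \<open>m\<close>, so \<open>eval_cong\<close> bridges the gap.\<close>

lemma eval_map_comp:
  assumes "morphism m n g" "length f = m"
  shows "eval_map (morphism_comp g f) p = eval_map g (eval_map f p)"
proof
  fix i
  have "eval (\<lambda>j. eval p (f ! j)) (g ! i) = eval (eval_map f p) (g ! i)" if "i < length g"
    by (rule eval_cong[of _ "{..<m}"]) (use assms that in \<open>auto simp: morphism_def eval_map_def\<close>)
  then show "eval_map (morphism_comp g f) p i = eval_map g (eval_map f p) i"
    by (auto simp: eval_map_def[of "morphism_comp g f"] eval_map_def[of g] eval_map_def[of "map _ _"]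
        morphism_comp_def eval_subst)
qed

lemma eval_map_identity: "p \<in> aff_space n \<Longrightarrow> eval_map (identity n) p = p"
  by (auto simp: eval_map_def identity_def aff_space_def)

text \<open>A monomial of degree at most 1 is 1 or a single variable, so \<open>l\<close> is zero or
  a coordinate.\<close>

lemma monom_value_affine:
  assumes "monom_degree m \<le> 1"
  obtains l where "\<And>(p :: nat \<Rightarrow> 'a::comm_ring_1) v t. monom_value (move p t v) m = monom_value p m + t * l v"
proof (cases "m = 0")
  case True
  then show ?thesis using that[of "\<lambda>_. 0"] by simp
next
  case False
  then obtain i where i: "i \<in> Poly_Mapping.keys m" by (metis keys_eq_empty all_not_in_conv)
  have d: "monom_degree m = Poly_Mapping.lookup m i + (\<Sum>j\<in>Poly_Mapping.keys m - {i}. Poly_Mapping.lookup m j)"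
    unfolding monom_degree_def by (rule sum.remove) (use i in auto)
  have "Poly_Mapping.lookup m i \<noteq> 0" using i by (simp add: in_keys_iff)
  then have 1: "Poly_Mapping.lookup m i = 1"
    and "(\<Sum>j\<in>Poly_Mapping.keys m - {i}. Poly_Mapping.lookup m j) = 0"
    using d assms by linarith+
  then have "Poly_Mapping.keys m = {i}" using i by (auto simp: in_keys_iff)
  then have "monom_value s m = s i" for s :: "nat \<Rightarrow> 'a" using 1 by (simp add: monom_value_def)
  then show ?thesis using that[of "\<lambda>v. v i"] by (simp add: move_def)
qed

lemma eval_affine:
  fixes p :: "'a::comm_ring_1 mpoly"
  assumes "total_degree p \<le> 1"
  obtains l where "\<And>s v t. eval (move s t v) p = eval s p + t * l v"
proof -
  have "monom_degree m \<le> 1" if "m \<in> Poly_Mapping.keys p" for m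
  proof -
    have "monom_degree m \<le> total_degree p"
      unfolding total_degree_def by (rule Max_ge) (use that in auto)
    then show ?thesis using assms by simp
  qed
  then have "\<forall>m\<in>Poly_Mapping.keys p. \<exists>l. \<forall>(s :: nat \<Rightarrow> 'a) v t. monom_value (move s t v) m = monom_value s m + t * l v"
    by (metis monom_value_affine)
  then obtain l where l: "\<And>m (s :: nat \<Rightarrow> 'a) v t. m \<in> Poly_Mapping.keys p \<Longrightarrow>
      monom_value (move s t v) m = monom_value s m + t * l m v"
    unfolding bchoice_iff by blast
  show ?thesis
    by (rule that[of "\<lambda>v. \<Sum>m\<in>Poly_Mapping.keys p. Poly_Mapping.lookup p m * l m v"])
      (simp add: eval_def l algebra_simps sum.distrib sum_distrib_left)
qed

text \<open>The degree bound speaks of \<open>f\<close> only. The polynomial inverse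
  \<open>g\<close> supplies the inverse map on points, and \<open>affine_isoI\<close> makes that map
  affine.\<close>

lemma affine_automorphism_affine_iso:
  assumes "affine_automorphism n f"
  obtains L B M where "affine_iso n (eval_map f) L B M"
proof -
  obtain g where m: "morphism n n f" "morphism n n g"
    and fg: "morphism_comp f g = identity n" "morphism_comp g f = identity n"
    using assms by (auto simp: affine_automorphism_def automorphism_def)
  have len: "length f = n" "length g = n" using m by (auto simp: morphism_def)
  have "total_degree q \<le> 1" if "q \<in> set f" for q
  proof -
    have "total_degree q \<le> morphism_degree f"
      unfolding morphism_degree_def by (rule Max_ge) (use that in auto)
    then show ?thesis using assms by (simp add: affine_automorphism_def)
  qed
  then have "\<forall>i<n. \<exists>l. \<forall>s v t. eval (move s t v) (f ! i) = eval s (f ! i) + t * l v"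
    using len by (metis eval_affine nth_mem)
  then obtain l where l: "\<And>i s v t. i < n \<Longrightarrow> eval (move s t v) (f ! i) = eval s (f ! i) + t * l i v"
    by metis
  have "affine_map n (eval_map f) (\<lambda>v i. if i < n then l i v else 0)"
    unfolding affine_map_def
    using len eval_map_in_aff_space[of f]
    by (auto simp: aff_space_def eval_map_def l move_def[of "\<lambda>i. if i < n then _ i else _"])
  moreover have "eval_map f (eval_map g p) = p" "eval_map g (eval_map f p) = p" if "p \<in> aff_space n" for p
    using len fg eval_map_comp[OF m(1), of g p] eval_map_comp[OF m(2), of f p] eval_map_identity[OF that]
    by simp_all
  then have "mutually_inverse_on (aff_space n) (eval_map f) (eval_map g)"
    using len eval_map_in_aff_space[of f] eval_map_in_aff_space[of g]
    by (auto simp: mutually_inverse_on_def)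
  ultimately show ?thesis by (metis affine_isoI that)
qed

section \<open>Pencils of functions and their invariants\<close>

definition pencil :: "nat \<Rightarrow> ((nat \<Rightarrow> 'a::comm_ring_1) \<Rightarrow> nat \<Rightarrow> 'a) \<Rightarrow> ((nat \<Rightarrow> 'a) \<Rightarrow> 'a) set"
  where "pencil n F = {\<lambda>p. c0 + (\<Sum>i<n. c i * F p i) | c0 c. \<exists>i<n. c i \<noteq> 0}"

text \<open>Inverses and linear parts are kept as witnesses: the former give symmetry, the latter
  transport directions.\<close>

definition equivalent_maps ::
    "nat \<Rightarrow> nat \<Rightarrow> ((nat \<Rightarrow> 'a::comm_ring_1) \<Rightarrow> nat \<Rightarrow> 'a) \<Rightarrow> ((nat \<Rightarrow> 'a) \<Rightarrow> nat \<Rightarrow> 'a) \<Rightarrow> bool" where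
  "equivalent_maps d n F G \<longleftrightarrow> F ` aff_space d \<subseteq> aff_space n \<and> G ` aff_space d \<subseteq> aff_space n \<and>
    (\<exists>A L A' L' B M B' M'. affine_iso n A L A' L' \<and> affine_iso d B M B' M' \<and>
      (\<forall>p\<in>aff_space d. F p = A (G (B p))))"

lemma equivalent_maps_sym:
  assumes "equivalent_maps d n F G"
  shows "equivalent_maps d n G F"
proof -
  obtain A L A' L' B M B' M' where A: "affine_iso n A L A' L'" and B: "affine_iso d B M B' M'"
    and F: "\<And>p. p \<in> aff_space d \<Longrightarrow> F p = A (G (B p))"
    using assms by (auto simp: equivalent_maps_def)
  have "G p = A' (F (B' p))" if "p \<in> aff_space d" for p
  proof -
    have "B' p \<in> aff_space d" "B (B' p) = p" "G p \<in> aff_space n"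
      using B that assms by (auto simp: affine_iso_def mutually_inverse_on_def equivalent_maps_def)
    then show ?thesis using A F[of "B' p"] by (simp add: affine_iso_def mutually_inverse_on_def)
  qed
  moreover have "affine_iso n A' L' A L" "affine_iso d B' M' B M"
    using A B affine_iso_sym by metis+
  moreover have "F ` aff_space d \<subseteq> aff_space n" "G ` aff_space d \<subseteq> aff_space n"
    using assms by (simp_all add: equivalent_maps_def)
  ultimately show ?thesis
    unfolding equivalent_maps_def by metis
qed

lemma equivalent_systems_equivalent_maps:
  assumes "morphism d n f" "morphism d n g" "equivalent_systems d n f g"
  shows "equivalent_maps d n (eval_map f) (eval_map g)"
proof -
  obtain \<alpha> \<beta> where \<alpha>: "affine_automorphism n \<alpha>" and \<beta>: "affine_automorphism d \<beta>"
    and f: "f = morphism_comp \<alpha> (morphism_comp g \<beta>)"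
    using assms(3) by (auto simp: equivalent_systems_def)
  have m: "morphism n n \<alpha>" "morphism d d \<beta>"
    using \<alpha> \<beta> by (auto simp: affine_automorphism_def automorphism_def)
  have "eval_map f p = eval_map \<alpha> (eval_map g (eval_map \<beta> p))" for p
    using m assms(2) unfolding f
    by (subst eval_map_comp[OF m(1)], simp add: morphism_def morphism_comp_def)
      (subst eval_map_comp[OF assms(2)], simp_all add: morphism_def)
  moreover obtain L A' L' where "affine_iso n (eval_map \<alpha>) L A' L'"
    using affine_automorphism_affine_iso[OF \<alpha>] by blast
  moreover obtain M B' M' where "affine_iso d (eval_map \<beta>) M B' M'"
    using affine_automorphism_affine_iso[OF \<beta>] by blast
  moreover have "eval_map f ` aff_space d \<subseteq> aff_space n" "eval_map g ` aff_space d \<subseteq> aff_space n"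
    using eval_map_in_aff_space[of f] eval_map_in_aff_space[of g] assms(1,2)
    by (auto simp: morphism_def)
  ultimately show ?thesis
    unfolding equivalent_maps_def by metis
qed

text \<open>A member of the pencil of \<open>F\<close> is an affine functional \<open>u\<close> of
  \<open>G (B p)\<close>, hence a constant plus a combination of the components of \<open>G\<close>.
  One \<open>B\<close> serves all members, on which \<open>common_translation_transfer\<close>
  relies.\<close>

lemma equivalent_maps_pencil:
  assumes "equivalent_maps d n F G"
  obtains B M B' M' where "affine_iso d B M B' M'"
    "\<And>h. h \<in> pencil n F \<Longrightarrow> \<exists>h'\<in>pencil n G. \<forall>p\<in>aff_space d. h p = h' (B p)"
proof -
  obtain A L A' L' B M B' M' where A: "affine_iso n A L A' L'" and B: "affine_iso d B M B' M'"
    and F: "\<And>p. p \<in> aff_space d \<Longrightarrow> F p = A (G (B p))"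
    using assms by (auto simp: equivalent_maps_def)
  have "\<exists>h'\<in>pencil n G. \<forall>p\<in>aff_space d. h p = h' (B p)" if "h \<in> pencil n F" for h
  proof -
    obtain c0 c i where h: "h = (\<lambda>p. c0 + (\<Sum>i<n. c i * F p i))" and i: "i < n" "c i \<noteq> 0"
      using \<open>h \<in> pencil n F\<close> by (auto simp: pencil_def)
    define u where "u q = c0 + (\<Sum>i<n. c i * A q i)" for q
    define l where "l v = (\<Sum>i<n. c i * L v i)" for v
    have u: "affine_functional n u l"
      using affine_functional_coord_sum[of n A L c0 c] A unfolding u_def l_def affine_iso_def by blast
    \<comment> \<open>\<open>L\<close> maps \<open>e\<close> to the unit vector of index
      \<open>i\<close>, so \<open>l\<close> takes the nonzero value \<open>c i\<close> at
      \<open>e\<close>. Hence the new coefficients \<open>l (unit_vec j)\<close> do not all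
      vanish.\<close>
    define e where "e = L' (unit_vec i)"
    have e: "e \<in> aff_space n" "L e = unit_vec i"
      using A i(1) by (auto simp: e_def affine_iso_def mutually_inverse_on_def)
    have "l e = c i"
      unfolding l_def e(2) by (simp add: unit_vec_def if_distrib[of "(*) _"] i(1) cong: if_cong)
    then have "(\<Sum>j<n. e j * l (unit_vec j)) \<noteq> 0"
      using affine_functional_linear_part[OF u e(1)] i(2) by simp
    then obtain j where "j < n" "l (unit_vec j) \<noteq> 0"
      by (metis (mono_tags, lifting) lessThan_iff mult_zero_right sum.neutral)
    then have "(\<lambda>p. u (\<lambda>_. 0) + (\<Sum>j<n. l (unit_vec j) * G p j)) \<in> pencil n G"
      unfolding pencil_def mem_Collect_eq
      by (intro exI[of _ "u (\<lambda>_. 0)"] exI[of _ "\<lambda>j. l (unit_vec j)"]) auto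
    moreover have "h p = u (\<lambda>_. 0) + (\<Sum>j<n. l (unit_vec j) * G (B p) j)" if p: "p \<in> aff_space d" for p
    proof -
      have "B p \<in> aff_space d" using B p by (auto simp: affine_iso_def mutually_inverse_on_def)
      then have "G (B p) \<in> aff_space n" using assms by (auto simp: equivalent_maps_def)
      moreover have "h p = u (G (B p))" using p by (simp add: h u_def F)
      ultimately show ?thesis
        using affine_functional_coords[OF u, of "G (B p)"] by (simp add: mult.commute)
    qed
    ultimately show ?thesis by (intro bexI[of _ "\<lambda>p. u (\<lambda>_. 0) + (\<Sum>j<n. l (unit_vec j) * G p j)"]) auto
  qed
  then show ?thesis by (rule that[OF B])
qed

section \<open>Invariants of pencils and their transfer along an equivalence\<close>

text \<open>Over a field, in affine coordinates whose first axis has direction \<open>v\<close>,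
  such an \<open>h\<close> is \<open>c\<close> times the first coordinate plus a function of the
  others.\<close>

definition coordinate_like :: "nat \<Rightarrow> ((nat \<Rightarrow> 'a::comm_ring_1) \<Rightarrow> 'a) \<Rightarrow> bool"
  where "coordinate_like d h \<longleftrightarrow> (\<exists>v\<in>aff_space d. \<exists>c. c \<noteq> 0 \<and>
    (\<forall>p\<in>aff_space d. \<forall>t. h (move p t v) = h p + t * c))"

text \<open>On each line of direction \<open>v\<close> the function is affine, with a slope that
  varies affinely from line to line. The zero direction would satisfy the identity for every
  \<open>h\<close>.\<close>

definition affine_slope :: "nat \<Rightarrow> ((nat \<Rightarrow> 'a::comm_ring_1) \<Rightarrow> 'a) \<Rightarrow> bool"
  where "affine_slope d h \<longleftrightarrow> (\<exists>v\<in>aff_space d. v \<noteq> (\<lambda>_. 0) \<and> (\<exists>u l. affine_functional d u l \<and>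
    (\<forall>p\<in>aff_space d. \<forall>t. h (move p t v) = h p + t * u p)))"

text \<open>The direction is chosen before \<open>h\<close>, and the slope may be 0, in contrast to
  \<open>coordinate_like\<close>.\<close>

definition common_translation :: "nat \<Rightarrow> ((nat \<Rightarrow> 'a::comm_ring_1) \<Rightarrow> 'a) set \<Rightarrow> bool"
  where "common_translation d H \<longleftrightarrow> (\<exists>v\<in>aff_space d. v \<noteq> (\<lambda>_. 0) \<and>
    (\<forall>h\<in>H. \<exists>c. \<forall>p\<in>aff_space d. \<forall>t. h (move p t v) = h p + t * c))"

lemma affine_slopeI:
  assumes "v \<in> aff_space d" "v \<noteq> (\<lambda>_. 0)" "affine_functional d u l"
    "\<And>p t. p \<in> aff_space d \<Longrightarrow> h (move p t v) = h p + t * u p"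
  shows "affine_slope d h"
  unfolding affine_slope_def
  by (rule bexI[OF _ assms(1)], rule conjI[OF assms(2)], rule exI[of _ u], rule exI[of _ l])
    (simp add: assms)

context
  fixes d n :: nat and F G :: "(nat \<Rightarrow> 'a::comm_ring_1) \<Rightarrow> nat \<Rightarrow> 'a"
  assumes eq: "equivalent_maps d n F G"
begin

text \<open>The direction \<open>v\<close> is pulled back to \<open>M' v\<close>: when the argument
  of \<open>B\<close> moves along \<open>M' v\<close>, its value moves along
  \<open>v\<close>.\<close>

lemma coordinate_like_transfer:
  assumes "\<forall>h\<in>pencil n G. coordinate_like d h"
  shows "\<forall>h\<in>pencil n F. coordinate_like d h"
proof
  fix h assume h: "h \<in> pencil n F"
  obtain B M B' M' where B: "affine_iso d B M B' M'"
    and "\<exists>h'\<in>pencil n G. \<forall>p\<in>aff_space d. h p = h' (B p)"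
    using equivalent_maps_pencil[OF eq] h by metis
  then obtain h' where h': "h' \<in> pencil n G" "\<And>p. p \<in> aff_space d \<Longrightarrow> h p = h' (B p)" by blast
  obtain v c where v: "v \<in> aff_space d" "c \<noteq> 0"
    "\<And>p t. p \<in> aff_space d \<Longrightarrow> h' (move p t v) = h' p + t * c"
    using assms h'(1) unfolding coordinate_like_def by blast
  have "M' v \<in> aff_space d" "M (M' v) = v"
    using B v(1) by (auto simp: affine_iso_def mutually_inverse_on_def)
  then show "coordinate_like d h"
    unfolding coordinate_like_def using B v
    by (intro bexI[of _ "M' v"] exI[of _ c])
      (auto simp: h' affine_iso_def affine_map_def image_subset_iff)
qed

text \<open>The direction is again \<open>M' v\<close>, with the slope composed with
  \<open>B\<close>. It is nonzero because \<open>M\<close> fixes 0 and sends \<open>M' v\<close> to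
  \<open>v\<close>.\<close>

lemma affine_slope_transfer:
  assumes "\<forall>h\<in>pencil n G. affine_slope d h"
  shows "\<forall>h\<in>pencil n F. affine_slope d h"
proof
  fix h assume h: "h \<in> pencil n F"
  obtain B M B' M' where B: "affine_iso d B M B' M'"
    and "\<exists>h'\<in>pencil n G. \<forall>p\<in>aff_space d. h p = h' (B p)"
    using equivalent_maps_pencil[OF eq] h by metis
  then obtain h' where h': "h' \<in> pencil n G" "\<And>p. p \<in> aff_space d \<Longrightarrow> h p = h' (B p)" by blast
  obtain v u l where v: "v \<in> aff_space d" "v \<noteq> (\<lambda>_. 0)" "affine_functional d u l"
    "\<And>p t. p \<in> aff_space d \<Longrightarrow> h' (move p t v) = h' p + t * u p"
    using assms h'(1) unfolding affine_slope_def by blast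
  have Mv: "M' v \<in> aff_space d" "M (M' v) = v"
    using B v(1) by (auto simp: affine_iso_def mutually_inverse_on_def)
  have "M' v \<noteq> (\<lambda>_. 0)" using affine_map_linear_zero[of d B M] B Mv v(2) by (auto simp: affine_iso_def)
  show "affine_slope d h"
  proof (rule affine_slopeI)
    show "M' v \<in> aff_space d" "M' v \<noteq> (\<lambda>_. 0)" by fact+
    show "affine_functional d (\<lambda>p. u (B p)) (\<lambda>v. l (M v))"
      using affine_functional_comp[OF v(3)] B by (simp add: affine_iso_def)
    show "h (move p t (M' v)) = h p + t * u (B p)" if "p \<in> aff_space d" for p t
      using B v Mv that by (auto simp: h' affine_iso_def affine_map_def image_subset_iff)
  qed
qed

lemma common_translation_transfer:
  assumes "common_translation d (pencil n G)"
  shows "common_translation d (pencil n F)"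
proof -
  obtain B M B' M' where B: "affine_iso d B M B' M'"
    and h': "\<And>h. h \<in> pencil n F \<Longrightarrow> \<exists>h'\<in>pencil n G. \<forall>p\<in>aff_space d. h p = h' (B p)"
    using equivalent_maps_pencil[OF eq] by metis
  obtain v where v: "v \<in> aff_space d" "v \<noteq> (\<lambda>_. 0)"
    "\<And>h. h \<in> pencil n G \<Longrightarrow> \<exists>c. \<forall>p\<in>aff_space d. \<forall>t. h (move p t v) = h p + t * c"
    using assms unfolding common_translation_def by blast
  have Mv: "M' v \<in> aff_space d" "M (M' v) = v"
    using B v(1) by (auto simp: affine_iso_def mutually_inverse_on_def)
  have "M' v \<noteq> (\<lambda>_. 0)" using affine_map_linear_zero[of d B M] B Mv v(2) by (auto simp: affine_iso_def)
  moreover have "\<exists>c. \<forall>p\<in>aff_space d. \<forall>t. h (move p t (M' v)) = h p + t * c" if h: "h \<in> pencil n F" for h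
  proof -
    obtain k where k: "k \<in> pencil n G" "\<And>p. p \<in> aff_space d \<Longrightarrow> h p = k (B p)" using h'[OF h] by blast
    obtain c where "\<And>p t. p \<in> aff_space d \<Longrightarrow> k (move p t v) = k p + t * c" using v(3)[OF k(1)] by blast
    then show ?thesis using B v Mv
      by (intro exI[of _ c]) (auto simp: k(2) affine_iso_def affine_map_def image_subset_iff)
  qed
  ultimately show ?thesis
    unfolding common_translation_def using Mv(1) by (intro bexI[of _ "M' v"]) auto
qed

text \<open>This transfer runs from \<open>F\<close> to \<open>G\<close>: the partner of
  \<open>h\<close> is \<open>h\<close> composed with the affine map \<open>B'\<close>, and such a
  composition stays affine.\<close>

lemma affine_member_transfer:
  assumes "\<exists>h\<in>pencil n F. \<exists>l. affine_functional d h l"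
  shows "\<exists>h\<in>pencil n G. \<exists>l. affine_functional d h l"
proof -
  obtain h l where h: "h \<in> pencil n F" "affine_functional d h l" using assms by blast
  obtain B M B' M' where B: "affine_iso d B M B' M'"
    and "\<exists>h'\<in>pencil n G. \<forall>p\<in>aff_space d. h p = h' (B p)"
    using equivalent_maps_pencil[OF eq] h by metis
  then obtain h' where h': "h' \<in> pencil n G" "\<And>p. p \<in> aff_space d \<Longrightarrow> h p = h' (B p)" by blast
  have "h' p = h (B' p)" if "p \<in> aff_space d" for p
    using that B h'(2)[of "B' p"] by (auto simp: affine_iso_def mutually_inverse_on_def)
  moreover have "affine_functional d (\<lambda>p. h (B' p)) (\<lambda>v. l (M' v))"
    using affine_functional_comp[OF h(2)] B by (simp add: affine_iso_def)
  ultimately have "affine_functional d h' (\<lambda>v. l (M' v))"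
    by (simp add: affine_functional_def)
  then show ?thesis using h'(1) by blast
qed

end

section \<open>Polynomial identities over an algebraically closed field\<close>

text \<open>Over a finite field the product of all linear factors, plus 1, would be a nonconstant
  polynomial with the value 1 everywhere, hence without root.\<close>

lemma infinite_alg_closed_field: "infinite (UNIV :: 'a::alg_closed_field set)"
proof
  assume fin: "finite (UNIV :: 'a set)"
  define P :: "'a poly" where "P = (\<Prod>a\<in>UNIV. [:-a, 1:])"
  have "degree P = card (UNIV :: 'a set)"
    by (simp add: P_def degree_prod_sum_eq)
  then have "degree P > 0"
    using fin by (simp add: finite_UNIV_card_ge_0)
  then have "degree (P + 1) > 0"
    by (simp add: degree_add_eq_left)
  then obtain x where "poly (P + 1) x = 0" using alg_closed_imp_poly_has_root by blast
  moreover have "poly P x = 0"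
    using fin by (simp add: P_def poly_prod)
  ultimately show False by simp
qed

text \<open>A nonzero polynomial has finitely many roots, but the field is infinite. Identities of
  lower degree are later padded with zero coefficients.\<close>

lemma cubic_identity_zero:
  fixes c0 c1 c2 c3 :: "'a::alg_closed_field"
  assumes "\<And>t. c0 + c1 * t + c2 * t ^ 2 + c3 * t ^ 3 = 0"
  shows "c0 = 0" "c1 = 0" "c2 = 0" "c3 = 0"
proof -
  have "poly [:c0, c1, c2, c3:] t = 0" for t
    using assms[of t] by (simp add: algebra_simps power2_eq_square power3_eq_cube)
  then have "{t. poly [:c0, c1, c2, c3:] t = 0} = UNIV" by simp
  then have "[:c0, c1, c2, c3:] = 0"
    using poly_roots_finite infinite_alg_closed_field by metis
  then show "c0 = 0" "c1 = 0" "c2 = 0" "c3 = 0" by (simp_all split: if_splits)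
qed

text \<open>Up to the names of the coordinates, \<open>\<phi>\<close> is the first component of
  families 2, 5, 6 and 11. Once \<open>b = 0\<close>, the constant \<open>w\<close> equals
  \<open>c\<close>, and both \<open>\<alpha> * c ^ 2\<close> and \<open>\<beta> * c\<close> turn out
  to vanish.\<close>

lemma cubic_no_translation:
  fixes a b c w \<alpha> \<beta> \<gamma> :: "'a::alg_closed_field"
  defines "\<phi> \<equiv> \<lambda>A B C. A * B + B * (\<alpha> * C ^ 2 + \<beta> * C * B + \<gamma> * B ^ 2) + C"
  assumes eq: "\<And>A B C t. \<phi> (A + t * a) (B + t * b) (C + t * c) = \<phi> A B C + t * w"
    and nz: "\<alpha> \<noteq> 0 \<or> \<beta> \<noteq> 0"
  shows "w = 0"
proof -
  \<comment> \<open>Compare A = 1 with A = 0 at B = C = 0 and t = 1.\<close>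
  have "b = 0"
    using eq[of 1 1 0 0] eq[of 0 1 0 0] by (simp add: \<phi>_def algebra_simps)
  have "w = c"
    using eq[of 0 1 0 0] by (simp add: \<phi>_def \<open>b = 0\<close>)
  \<comment> \<open>Set A = C = 0; the coefficients of the powers of t are polynomials in B.\<close>
  have 1: "0 + (a * B + \<beta> * c * B ^ 2) * t + \<alpha> * c ^ 2 * B * t ^ 2 + 0 * t ^ 3 = 0" for B t
    using eq[of 0 t B 0]
    by (simp add: \<phi>_def \<open>b = 0\<close> \<open>w = c\<close> algebra_simps power2_eq_square)
  have "\<alpha> * c ^ 2 = 0"
    using cubic_identity_zero(3)[OF 1[of 1]] by simp
  \<comment> \<open>The coefficient of t vanishes for every B, so its own coefficient at the square
    of B vanishes too.\<close>
  moreover have "0 + a * B + \<beta> * c * B ^ 2 + 0 * B ^ 3 = 0" for B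
    using cubic_identity_zero(2)[OF 1[of B]] by simp
  from cubic_identity_zero(3)[OF this] have "\<beta> * c = 0" .
  ultimately show "w = 0" using nz \<open>w = c\<close> by auto
qed

lemma family3_no_affine_slope:
  fixes a b c l0 l1 l2 l3 \<alpha> \<beta> :: "'a::alg_closed_field"
  defines "\<phi> \<equiv> \<lambda>x y z. x * y ^ 2 + y * (z ^ 2 + \<alpha> * z + \<beta>) + z"
  assumes eq: "\<And>x y z t. \<phi> (x + t * a) (y + t * b) (z + t * c) =
      \<phi> x y z + t * (l0 + l1 * x + l2 * y + l3 * z)"
  shows "a = 0" "b = 0" "c = 0"
proof -
  \<comment> \<open>Difference of the identities at x = 1 and x = 0, with y = z = 0.\<close>
  have "0 + (- l1) * t + b ^ 2 * t ^ 2 + 0 * t ^ 3 = 0" for t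
    using arg_cong2[where f = "(-)", OF eq[of 1 t 0 0] eq[of 0 t 0 0]]
    by (simp add: \<phi>_def algebra_simps power2_eq_square)
  from cubic_identity_zero(3)[OF this] show "b = 0" by simp
  \<comment> \<open>Difference of the identities at y = 1 and y = 0, with x = z = 0.\<close>
  have "0 + (a + \<alpha> * c - l2) * t + c ^ 2 * t ^ 2 + 0 * t ^ 3 = 0" for t
    using arg_cong2[where f = "(-)", OF eq[of 0 t 1 0] eq[of 0 t 0 0]]
    by (simp add: \<phi>_def \<open>b = 0\<close> algebra_simps power2_eq_square)
  from cubic_identity_zero(3)[OF this] show "c = 0" by simp
  \<comment> \<open>At x = z = 0 and t = 1 the left side grows by \<open>a * y ^ 2\<close>, while
    the slope has degree at most 1 in y.\<close>
  have "- l0 + (- l2) * y + a * y ^ 2 + 0 * y ^ 3 = 0" for y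
    using eq[of 0 1 y 0] \<open>b = 0\<close> \<open>c = 0\<close>
    by (simp add: \<phi>_def algebra_simps power2_eq_square)
  from cubic_identity_zero(3)[OF this] show "a = 0" .
qed

section \<open>The invariants of the eleven families\<close>

definition point :: "'a::zero \<Rightarrow> 'a \<Rightarrow> 'a \<Rightarrow> nat \<Rightarrow> 'a"
  where "point x y z = (\<lambda>_. 0)(0 := x, 1 := y, 2 := z)"

lemma point_nth [simp]: "point x y z 0 = x" "point x y z (Suc 0) = y" "point x y z 2 = z"
  by (simp_all add: point_def)

lemma point_eq_zero [simp]: "point x y z = (\<lambda>_. 0) \<longleftrightarrow> x = 0 \<and> y = 0 \<and> z = 0"
proof
  assume "point x y z = (\<lambda>_. 0)"
  then show "x = 0 \<and> y = 0 \<and> z = 0" by (metis point_nth)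
qed (simp add: point_def fun_eq_iff)

lemma point_in_aff_space [simp]: "point x y z \<in> aff_space 3"
  by (auto simp: point_def aff_space_def)

lemma aff_space_3_eq_zero: "v \<in> aff_space 3 \<Longrightarrow> v = (\<lambda>_. 0) \<longleftrightarrow> v 0 = 0 \<and> v 1 = 0 \<and> v 2 = 0"
proof
  assume v: "v \<in> aff_space 3" and "v 0 = 0 \<and> v 1 = 0 \<and> v 2 = 0"
  then have "v i = 0" for i
    by (cases "i \<ge> 3") (auto simp: aff_space_def not_le eval_nat_numeral less_Suc_eq)
  then show "v = (\<lambda>_. 0)" by auto
qed auto

lemma move_nth: "move p t v i = p i + t * v i"
  by (simp add: move_def)

text \<open>The number of components is written with \<open>Suc\<close> to match the simplified
  length of a literal list.\<close>

lemma pencil_singleton: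
  "pencil (Suc 0) (eval_map [f1]) = {\<lambda>p. c0 + c1 * eval p f1 | c0 c1. c1 \<noteq> 0}"
  by (auto simp: pencil_def eval_map_def)

lemma pencil_pair:
  "pencil (Suc (Suc 0)) (eval_map [f1, f2]) =
    {\<lambda>p. c0 + c1 * eval p f1 + c2 * eval p f2 | c0 c1 c2. c1 \<noteq> 0 \<or> c2 \<noteq> 0}" (is "?P = ?Q")
proof
  show "?P \<subseteq> ?Q"
    by (fastforce simp: pencil_def eval_map_def less_Suc_eq add.assoc)
  show "?Q \<subseteq> ?P"
  proof
    fix h assume "h \<in> ?Q"
    then obtain c0 c1 c2 where "h = (\<lambda>p. c0 + c1 * eval p f1 + c2 * eval p f2)" "c1 \<noteq> 0 \<or> c2 \<noteq> 0" by auto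
    then show "h \<in> ?P"
      unfolding pencil_def
      by (intro CollectI exI[of _ c0] exI[of _ "\<lambda>i. if i = 0 then c1 else c2"])
        (auto simp: eval_map_def add.assoc less_Suc_eq)
  qed
qed

lemma pencil_triple:
  "pencil (Suc (Suc (Suc 0))) (eval_map [f1, f2, f3]) =
    {\<lambda>p. c0 + c1 * eval p f1 + c2 * eval p f2 + c3 * eval p f3 | c0 c1 c2 c3.
      c1 \<noteq> 0 \<or> c2 \<noteq> 0 \<or> c3 \<noteq> 0}" (is "?P = ?Q")
proof
  show "?P \<subseteq> ?Q"
    by (fastforce simp: pencil_def eval_map_def less_Suc_eq add.assoc)
  show "?Q \<subseteq> ?P"
  proof
    fix h assume "h \<in> ?Q"
    then obtain c0 c1 c2 c3 where "h = (\<lambda>p. c0 + c1 * eval p f1 + c2 * eval p f2 + c3 * eval p f3)"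
      "c1 \<noteq> 0 \<or> c2 \<noteq> 0 \<or> c3 \<noteq> 0" by auto
    then show "h \<in> ?P"
      unfolding pencil_def
      by (intro CollectI exI[of _ c0] exI[of _ "\<lambda>i. if i = 0 then c1 else if i = 1 then c2 else c3"])
        (auto simp: eval_map_def add.assoc less_Suc_eq)
  qed
qed

lemma eval_in_pencil:
  assumes "i < length f"
  shows "(\<lambda>p. eval p (f ! i)) \<in> pencil (length f) (eval_map f)"
  unfolding pencil_def
proof (intro CollectI exI conjI)
  show "(\<lambda>p. eval p (f ! i)) = (\<lambda>p. 0 + (\<Sum>j<length f. (if j = i then 1 else 0) * eval_map f p j))"
    using assms by (simp add: eval_map_def if_distrib[of "\<lambda>x. x * _"] cong: if_cong)
qed (use assms in auto)

section \<open>Criteria for the invariants to hold or to fail\<close>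

text \<open>A constant slope is an affine functional, and \<open>c \<noteq> 0\<close> rules out the
  zero direction. The contrapositive settles families 3 and 7.\<close>

lemma coordinate_like_imp_affine_slope:
  assumes "coordinate_like d h"
  shows "affine_slope d h"
proof -
  obtain v c where v: "v \<in> aff_space d" "c \<noteq> 0"
    "\<And>p t. p \<in> aff_space d \<Longrightarrow> h (move p t v) = h p + t * c"
    using assms unfolding coordinate_like_def by blast
  have "move (\<lambda>_. 0) 1 (\<lambda>_. 0) = (\<lambda>_::nat. 0 :: 'a)" by (simp add: move_def)
  then have "v \<noteq> (\<lambda>_. 0)"
    using v(2) v(3)[of "\<lambda>_. 0" 1] by auto
  then show ?thesis
    using v by (intro affine_slopeI[of v _ "\<lambda>_. c" "\<lambda>_. 0"]) (auto simp: affine_functional_def)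
qed

lemma coordinate_likeI:
  assumes "c \<noteq> 0" "\<And>p t. p \<in> aff_space 3 \<Longrightarrow> h (move p t (point x y z)) = h p + t * c"
  shows "coordinate_like 3 h"
  unfolding coordinate_like_def using assms by (intro bexI[of _ "point x y z"]) auto

text \<open>The indices are a permutation of the three coordinates, so one lemma covers family 2
  with (0, 1, 2) and families 5, 6, 11 with (1, 2, 0).\<close>

lemma not_coordinate_like_cubic:
  fixes h :: "(nat \<Rightarrow> 'a::alg_closed_field) \<Rightarrow> 'a"
  assumes ijk: "{i, j, k} = {..<3}"
    and h: "\<And>p. h p = p i * p j + p j * (\<alpha> * p k ^ 2 + \<beta> * p k * p j + \<gamma> * p j ^ 2) + p k"
    and nz: "\<alpha> \<noteq> 0 \<or> \<beta> \<noteq> 0"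
  shows "\<not> coordinate_like 3 h"
proof
  assume "coordinate_like 3 h"
  then obtain v w where v: "w \<noteq> 0" "\<And>p t. p \<in> aff_space 3 \<Longrightarrow> h (move p t v) = h p + t * w"
    unfolding coordinate_like_def by blast
  have dist: "i \<noteq> j" "i \<noteq> k" "j \<noteq> k" "i < 3" "j < 3" "k < 3"
  proof -
    have "card {i, j, k} = 3" unfolding ijk by simp
    then show "i \<noteq> j" "i \<noteq> k" "j \<noteq> k" by (auto simp: card_insert_if split: if_splits)
    show "i < 3" "j < 3" "k < 3" using ijk by auto
  qed
  have "w = 0"
  proof (rule cubic_no_translation[OF _ nz])
    fix A B C t :: 'a
    define p where "p = (\<lambda>_. 0)(i := A, j := B, k := C)"
    have "p \<in> aff_space 3" using dist by (auto simp: p_def aff_space_def)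
    from v(2)[OF this, of t]
    show "(A + t * v i) * (B + t * v j) + (B + t * v j) * (\<alpha> * (C + t * v k) ^ 2
        + \<beta> * (C + t * v k) * (B + t * v j) + \<gamma> * (B + t * v j) ^ 2) + (C + t * v k)
      = A * B + B * (\<alpha> * C ^ 2 + \<beta> * C * B + \<gamma> * B ^ 2) + C + t * w"
      using dist by (simp add: h move_nth p_def)
  qed
  then show False using v(1) by simp
qed

lemma not_affine_slope_family3:
  fixes h :: "(nat \<Rightarrow> 'a::alg_closed_field) \<Rightarrow> 'a"
  assumes h: "\<And>p. h p = p 0 * p 1 ^ 2 + p 1 * (p 2 ^ 2 + \<alpha> * p 2 + \<beta>) + p 2"
  shows "\<not> affine_slope 3 h"
proof
  assume "affine_slope 3 h"
  then obtain v u l where v: "v \<in> aff_space 3" "v \<noteq> (\<lambda>_. 0)" "affine_functional 3 u l"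
    "\<And>p t. p \<in> aff_space 3 \<Longrightarrow> h (move p t v) = h p + t * u p"
    unfolding affine_slope_def by blast
  have "(x + t * v 0) * (y + t * v 1) ^ 2 + (y + t * v 1) * ((z + t * v 2) ^ 2 + \<alpha> * (z + t * v 2) + \<beta>)
      + (z + t * v 2) = x * y ^ 2 + y * (z ^ 2 + \<alpha> * z + \<beta>) + z
      + t * (u (\<lambda>_. 0) + l (unit_vec 0) * x + l (unit_vec 1) * y + l (unit_vec 2) * z)" for x y z t
  proof -
    have "u (point x y z) = u (\<lambda>_. 0) + l (unit_vec 0) * x + l (unit_vec 1) * y + l (unit_vec 2) * z"
      using affine_functional_coords[OF v(3), of "point x y z"]
      \<comment> \<open>The sum is unrolled in \<open>Suc\<close> notation; the second call restores
        the index 2 so that \<open>point_nth\<close> applies.\<close>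
      by (simp add: numeral_3_eq_3 ac_simps) (simp add: numeral_2_eq_2[symmetric])
    then show ?thesis
      using v(4)[of "point x y z" t] by (simp add: h move_nth)
  qed
  from family3_no_affine_slope[OF this] have "v 0 = 0" "v 1 = 0" "v 2 = 0" .
  then show False using v(1,2) aff_space_3_eq_zero by blast
qed

lemma eval_move_eq:
  assumes "p \<in> polys_in {i, j}" "v i = 0" "v j = 0"
  shows "eval (move s t v) p = eval s p"
  by (rule eval_cong[OF assms(1)]) (use assms(2,3) in \<open>auto simp: move_nth\<close>)

lemma nth_root_obtains:
  fixes c :: "'a::alg_closed_field"
  assumes "n > 0"
  obtains x where "x ^ n = c"
  using nth_root_exists[OF assms] by blast

section \<open>Constant nonzero slopes: families 1, 4, 8, 9, 10 against the others\<close>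

text \<open>Families 1, 4 and 10 are triangular: the axis of the first component with nonzero
  coefficient is a direction. In families 8 and 9 the power of \<open>X\<close> in the second
  component has to be compensated, by a direction depending on \<open>c2 / c1\<close>.\<close>

lemma coordinate_like_pencil:
  fixes f :: "'a::alg_closed_field mpoly list"
  assumes "family k f" "k \<in> {1, 4, 8, 9, 10}" "h \<in> pencil (length f) (eval_map f)"
  shows "coordinate_like 3 h"
  using assms(1)
proof cases
  case (fam1 r2 r3)
  then obtain c0 c1 where "c1 \<noteq> 0" "h = (\<lambda>p. c0 + c1 * eval p (X + r2 + r3))"
    using assms(3) by (auto simp: pencil_singleton)
  then show ?thesis
    using fam1 by (intro coordinate_likeI[of c1 _ 1 0 0])
      (auto simp: move_nth eval_move_eq[of _ 1 2] algebra_simps)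
next
  case (fam4 p2 p3 q2 q3)
  then obtain c0 c1 c2 where c: "c1 \<noteq> 0 \<or> c2 \<noteq> 0"
    and h: "h = (\<lambda>p. c0 + c1 * eval p (X + p2 + p3) + c2 * eval p (Y + Const q2 * Z^2 + Const q3 * Z^3))"
    using assms(3) by (auto simp: pencil_pair)
  show ?thesis
  proof (cases "c1 = 0")
    case True
    then show ?thesis
      using c fam4 by (intro coordinate_likeI[of c2 _ 0 1 0]) (auto simp: h move_nth algebra_simps)
  next
    case False
    then show ?thesis
      using fam4 by (intro coordinate_likeI[of c1 _ 1 0 0])
        (auto simp: h move_nth eval_move_eq[of _ 1 2] algebra_simps)
  qed
next
  case fam8
  then obtain c0 c1 c2 where c: "c1 \<noteq> 0 \<or> c2 \<noteq> 0"
    and h: "h = (\<lambda>p. c0 + c1 * eval p (X + Z^2 + Y^3) + c2 * eval p (Y + X^2))"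
    using assms(3) by (auto simp: pencil_pair)
  have two: "(2 :: 'a) = 0" using of_nat_CHAR[where 'a = 'a] fam8 by simp
  show ?thesis
  proof (cases "c1 = 0")
    case True
    then show ?thesis
      using c by (intro coordinate_likeI[of c2 _ 0 1 0]) (auto simp: h move_nth algebra_simps)
  next
    case False
    \<comment> \<open>Squaring is additive, so the quadratic terms cancel along \<open>(1, 0, s)\<close>.\<close>
    obtain s where s: "s ^ 2 = - (c2 / c1)" using nth_root_obtains[of 2] by auto
    then have s': "c1 * s ^ 2 = - c2" using False by simp
    have "c1 * (t * s) ^ 2 + c2 * t ^ 2 = 0" for t
    proof -
      have "c1 * (t * s) ^ 2 + c2 * t ^ 2 = t ^ 2 * (c1 * s ^ 2) + c2 * t ^ 2"
        by (simp add: power_mult_distrib ac_simps)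
      then show ?thesis unfolding s' by simp
    qed
    moreover have sq: "(x + y) ^ 2 = x ^ 2 + y ^ 2" for x y :: 'a
      by (simp add: power2_sum two)
    ultimately show ?thesis
      using False
      by (intro coordinate_likeI[of c1 _ 1 0 s])
        (auto simp: h move_nth sq algebra_simps)
  qed
next
  case fam9
  then obtain c0 c1 c2 where c: "c1 \<noteq> 0 \<or> c2 \<noteq> 0"
    and h: "h = (\<lambda>p. c0 + c1 * eval p (X + Z^2 + Y^3) + c2 * eval p (Z + X^3))"
    using assms(3) by (auto simp: pencil_pair)
  have three: "(3 :: 'a) = 0" using of_nat_CHAR[where 'a = 'a] fam9 by simp
  show ?thesis
  proof (cases "c1 = 0")
    case True
    then show ?thesis
      using c by (intro coordinate_likeI[of c2 _ 0 0 1]) (auto simp: h move_nth algebra_simps)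
  next
    case False
    \<comment> \<open>Cubing is additive, so the cubic terms cancel along \<open>(1, s, 0)\<close>.\<close>
    obtain s where s: "s ^ 3 = - (c2 / c1)" using nth_root_obtains[of 3] by auto
    then have s': "c1 * s ^ 3 = - c2" using False by simp
    have "c1 * (t * s) ^ 3 + c2 * t ^ 3 = 0" for t
    proof -
      have "c1 * (t * s) ^ 3 + c2 * t ^ 3 = t ^ 3 * (c1 * s ^ 3) + c2 * t ^ 3"
        by (simp add: power_mult_distrib ac_simps)
      then show ?thesis unfolding s' by simp
    qed
    moreover have cu: "(x + y) ^ 3 = x ^ 3 + y ^ 3" for x y :: 'a
    proof -
      have "(x + y) ^ 3 = x ^ 3 + y ^ 3 + 3 * (x ^ 2 * y + x * y ^ 2)"
        by (simp add: power3_eq_cube power2_eq_square algebra_simps)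
      then show ?thesis by (simp add: three)
    qed
    ultimately show ?thesis
      using False
      by (intro coordinate_likeI[of c1 _ 1 s 0])
        (auto simp: h move_nth cu algebra_simps)
  qed
next
  case (fam10 p2 p3 q2 q3)
  then obtain c0 c1 c2 c3 where c: "c1 \<noteq> 0 \<or> c2 \<noteq> 0 \<or> c3 \<noteq> 0"
    and h: "h = (\<lambda>p. c0 + c1 * eval p (X + p2 + p3) + c2 * eval p (Y + Const q2 * Z^2 + Const q3 * Z^3)
      + c3 * eval p Z)"
    using assms(3) by (auto simp: pencil_triple)
  consider "c1 \<noteq> 0" | "c1 = 0" "c2 \<noteq> 0" | "c1 = 0" "c2 = 0" "c3 \<noteq> 0" using c by blast
  then show ?thesis
  proof cases
    case 1
    then show ?thesis
      using fam10 by (intro coordinate_likeI[of c1 _ 1 0 0])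
        (auto simp: h move_nth eval_move_eq[of _ 1 2] algebra_simps)
  next
    case 2
    then show ?thesis
      by (intro coordinate_likeI[of c2 _ 0 1 0]) (auto simp: h move_nth algebra_simps)
  next
    case 3
    then show ?thesis
      by (intro coordinate_likeI[of c3 _ 0 0 1]) (auto simp: h move_nth algebra_simps)
  qed
qed (use assms(2) in auto)

text \<open>The first component is already a counterexample. In families 3 and 7 it even lacks an
  affine slope; elsewhere \<open>not_coordinate_like_cubic\<close> applies to it.\<close>

lemma not_coordinate_like_pencil:
  fixes f :: "'a::alg_closed_field mpoly list"
  assumes "family k f" "k \<notin> {1, 4, 8, 9, 10}"
  shows "\<exists>h\<in>pencil (length f) (eval_map f). \<not> coordinate_like 3 h"
proof -
  have "f \<noteq> [] \<and> \<not> coordinate_like 3 (\<lambda>p. eval p (f ! 0))"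
    using assms(1)
  proof cases
    case (fam2 r2)
    \<comment> \<open>Since \<open>r2\<close> lies outside \<open>k_y\<close> it involves z, so
      index 2 plays the first role in \<open>homogeneous2_eval\<close> and index 1 the
      second.\<close>
    obtain a b c where "\<And>s. eval s r2 = a * s 2 ^ 2 + b * s 2 * s 1 + c * s 1 ^ 2" "a \<noteq> 0 \<or> b \<noteq> 0"
      by (rule homogeneous2_eval[of 2 1 r2]) (use fam2 in \<open>auto simp: insert_commute\<close>)
    then have "\<not> coordinate_like 3 (\<lambda>p. eval p (f ! 0))"
      by (intro not_coordinate_like_cubic[of 0 1 2 _ a b c]) (auto simp: fam2)
    then show ?thesis using fam2 by simp
  next
    case (fam3 a b)
    have "\<not> affine_slope 3 (\<lambda>p. eval p (f ! 0))"
      by (rule not_affine_slope_family3[of _ a b]) (simp add: fam3)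
    then show ?thesis using fam3 coordinate_like_imp_affine_slope by auto
  next
    case (fam5 a2)
    obtain a b c where "\<And>s. eval s a2 = a * s 0 ^ 2 + b * s 0 * s 2 + c * s 2 ^ 2" "a \<noteq> 0 \<or> b \<noteq> 0"
      by (rule homogeneous2_eval[of 0 2 a2]) (use fam5 in auto)
    then have "\<not> coordinate_like 3 (\<lambda>p. eval p (f ! 0))"
      by (intro not_coordinate_like_cubic[of 1 2 0 _ a b c]) (auto simp: fam5)
    then show ?thesis using fam5 by simp
  next
    case (fam6 a2)
    obtain a b c where "\<And>s. eval s a2 = a * s 0 ^ 2 + b * s 0 * s 2 + c * s 2 ^ 2" "a \<noteq> 0 \<or> b \<noteq> 0"
      by (rule homogeneous2_eval[of 0 2 a2]) (use fam6 in auto)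
    then have "\<not> coordinate_like 3 (\<lambda>p. eval p (f ! 0))"
      by (intro not_coordinate_like_cubic[of 1 2 0 _ a b c]) (auto simp: fam6)
    then show ?thesis using fam6 by simp
  next
    case (fam7 a b)
    have "\<not> affine_slope 3 (\<lambda>p. eval p (f ! 0))"
      by (rule not_affine_slope_family3[of _ a b]) (simp add: fam7)
    then show ?thesis using fam7 coordinate_like_imp_affine_slope by auto
  next
    case (fam11 a2)
    obtain a b c where "\<And>s. eval s a2 = a * s 0 ^ 2 + b * s 0 * s 2 + c * s 2 ^ 2" "a \<noteq> 0 \<or> b \<noteq> 0"
      by (rule homogeneous2_eval[of 0 2 a2]) (use fam11 in auto)
    then have "\<not> coordinate_like 3 (\<lambda>p. eval p (f ! 0))"
      by (intro not_coordinate_like_cubic[of 1 2 0 _ a b c]) (auto simp: fam11)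
    then show ?thesis using fam11 by simp
  qed (use assms(2) in auto)
  then show ?thesis using eval_in_pencil[of 0 f] by blast
qed

lemma coordinate_like_pencil_iff:
  fixes f :: "'a::alg_closed_field mpoly list"
  assumes "family k f"
  shows "(\<forall>h\<in>pencil (length f) (eval_map f). coordinate_like 3 h) \<longleftrightarrow> k \<in> {1, 4, 8, 9, 10}"
proof (cases "k \<in> {1, 4, 8, 9, 10}")
  case True
  then show ?thesis using coordinate_like_pencil[OF assms True] by simp
next
  case False
  then show ?thesis using not_coordinate_like_pencil[OF assms False] by metis
qed

section \<open>Affine slopes: families 2 and 6 against 3 and 7\<close>

text \<open>In family 2 the variable x occurs only in x y, so moving along x has slope
  \<open>c1\<close> times y. In family 6 the variable y occurs only in y z, so moving along y has
  slope \<open>c1\<close> times z, possibly with \<open>c1 = 0\<close>.\<close>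

lemma affine_slope_pencil:
  fixes f :: "'a::alg_closed_field mpoly list"
  assumes "family k f" "k \<in> {2, 6}" "h \<in> pencil (length f) (eval_map f)"
  shows "affine_slope 3 h"
  using assms(1)
proof cases
  case (fam2 r2)
  then obtain c0 c1 where h: "c1 \<noteq> 0" "h = (\<lambda>p. c0 + c1 * eval p (X * Y + Y * r2 + Z))"
    using assms(3) by (auto simp: pencil_singleton)
  have ev: "eval (move p t (point 1 0 0)) r2 = eval p r2" for p t
    by (rule eval_move_eq[of _ 1 2]) (use fam2 in auto)
  show ?thesis
  proof (rule affine_slopeI)
    show "affine_functional 3 (\<lambda>p. c1 * p 1) (\<lambda>v. c1 * v 1)"
      by (simp add: affine_functional_def move_nth algebra_simps)
    show "h (move p t (point 1 0 0)) = h p + t * (c1 * p 1)" for p t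
      by (simp add: h ev) (simp add: move_nth algebra_simps)
  qed simp_all
next
  case (fam6 a2)
  then obtain c0 c1 c2 where h: "h = (\<lambda>p. c0 + c1 * eval p (Y * Z + Z * a2 + X) + c2 * eval p Z)"
    using assms(3) by (auto simp: pencil_pair)
  have ev: "eval (move p t (point 0 1 0)) a2 = eval p a2" for p t
    by (rule eval_move_eq[of _ 0 2]) (use fam6 in auto)
  show ?thesis
  proof (rule affine_slopeI)
    show "affine_functional 3 (\<lambda>p. c1 * p 2) (\<lambda>v. c1 * v 2)"
      by (simp add: affine_functional_def move_nth algebra_simps)
    show "h (move p t (point 0 1 0)) = h p + t * (c1 * p 2)" for p t
      by (simp add: h ev) (simp add: move_nth algebra_simps)
  qed simp_all
qed (use assms(2) in auto)

lemma not_affine_slope_pencil: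
  fixes f :: "'a::alg_closed_field mpoly list"
  assumes "family k f" "k \<in> {3, 7}"
  shows "\<exists>h\<in>pencil (length f) (eval_map f). \<not> affine_slope 3 h"
proof -
  have "f \<noteq> [] \<and> \<not> affine_slope 3 (\<lambda>p. eval p (f ! 0))"
    using assms(1)
  proof cases
    case (fam3 a b)
    have "\<not> affine_slope 3 (\<lambda>p. eval p (f ! 0))"
      by (rule not_affine_slope_family3[of _ a b]) (simp add: fam3)
    then show ?thesis using fam3 by auto
  next
    case (fam7 a b)
    have "\<not> affine_slope 3 (\<lambda>p. eval p (f ! 0))"
      by (rule not_affine_slope_family3[of _ a b]) (simp add: fam7)
    then show ?thesis using fam7 by auto
  qed (use assms(2) in auto)
  then show ?thesis using eval_in_pencil[of 0 f] by blast
qed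

section \<open>Affine members: families 6 and 7 against 5\<close>

lemma affine_member_pencil:
  fixes f :: "'a::alg_closed_field mpoly list"
  assumes "family k f" "k \<in> {6, 7}"
  shows "\<exists>h\<in>pencil (length f) (eval_map f). \<exists>l. affine_functional 3 h l"
proof -
  \<comment> \<open>The index is 2 in family 6 and 1 in family 7.\<close>
  have "length f = 2 \<and> (\<exists>i. f ! 1 = Var i)"
    using assms(1) by cases (use assms(2) in auto)
  then obtain i where "length f = 2" "f ! 1 = Var i" by blast
  then have "(\<lambda>p. p i) \<in> pencil (length f) (eval_map f)"
    using eval_in_pencil[of 1 f] by simp
  moreover have "affine_functional 3 (\<lambda>p. p i) (\<lambda>v. v i)"
    by (simp add: affine_functional_def move_nth)
  ultimately show ?thesis by blast
qed

lemma no_affine_member_pencil: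
  fixes f :: "'a::alg_closed_field mpoly list"
  assumes "family 5 f" "h \<in> pencil (length f) (eval_map f)"
  shows "\<not> affine_functional 3 h l"
proof
  assume aff: "affine_functional 3 h l"
  obtain a2 r1 r2 r3 where a2: "a2 \<in> k_xz - k_z" "homogeneous 2 a2"
    and f: "f = [Y * Z + Z * a2 + X, Y + a2 + Const r1 * Z + Const r2 * Z^2 + Const r3 * Z^3]"
    using assms(1) by cases auto
  obtain a b c where ev: "\<And>s. eval s a2 = a * s 0 ^ 2 + b * s 0 * s 2 + c * s 2 ^ 2"
    and nz: "a \<noteq> 0 \<or> b \<noteq> 0"
    by (rule homogeneous2_eval[of 0 2 a2]) (use a2 in auto)
  obtain c0 c1 c2 where c12: "c1 \<noteq> 0 \<or> c2 \<noteq> 0" and h: "h = (\<lambda>p. c0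
      + c1 * eval p (Y * Z + Z * a2 + X)
      + c2 * eval p (Y + a2 + Const r1 * Z + Const r2 * Z^2 + Const r3 * Z^3))"
    using assms(2) by (auto simp: f pencil_pair)
  have lin: "h (point x y z) = h (\<lambda>_. 0) + x * l (unit_vec 0) + y * l (unit_vec 1) + z * l (unit_vec 2)"
    for x y z
    using affine_functional_coords[OF aff, of "point x y z"]
    by (simp add: numeral_3_eq_3 ac_simps) (simp add: numeral_2_eq_2[symmetric])
  \<comment> \<open>The mixed second difference in y and z is 0 on affine functions and
    \<open>c1\<close> on \<open>h\<close>.\<close>
  have "c1 = 0"
    using lin[of 0 1 1] lin[of 0 1 0] lin[of 0 0 1] lin[of 0 0 0]
    by (simp add: h ev algebra_simps)
  then have c2: "c2 \<noteq> 0" using c12 by simp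
  \<comment> \<open>On the x-axis the quadratic coefficient of \<open>h\<close> is
    \<open>c2 * a\<close>.\<close>
  have "0 + (- l (unit_vec 0)) * x + c2 * a * x ^ 2 + 0 * x ^ 3 = 0" for x
    using lin[of x 0 0] lin[of 0 0 0] by (simp add: h ev \<open>c1 = 0\<close> algebra_simps)
  from cubic_identity_zero(3)[OF this] have "a = 0" using c2 by simp
  \<comment> \<open>The mixed second difference of \<open>h\<close> in x and z is
    \<open>c2 * b\<close>.\<close>
  moreover have "c2 * b = 0"
    using lin[of 1 0 1] lin[of 1 0 0] lin[of 0 0 1] lin[of 0 0 0]
    by (simp add: h ev \<open>c1 = 0\<close> \<open>a = 0\<close> algebra_simps)
  ultimately show False using nz c2 by simp
qed

section \<open>Common directions: family 4 against 8 and 9\<close>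

text \<open>Along the x-axis the first component has slope 1 and the second is constant, so every
  member has slope \<open>c1\<close>.\<close>

lemma common_translation_pencil:
  fixes f :: "'a::alg_closed_field mpoly list"
  assumes "family 4 f"
  shows "common_translation 3 (pencil (length f) (eval_map f))"
  unfolding common_translation_def
proof (intro bexI[of _ "point 1 0 0"] conjI ballI)
  show "point 1 0 0 \<noteq> (\<lambda>_. 0 :: 'a)" by simp
  fix h assume h: "h \<in> pencil (length f) (eval_map f)"
  obtain p2 p3 q2 q3 where f: "p2 \<in> k_yz" "p3 \<in> k_yz"
      "f = [X + p2 + p3, Y + Const q2 * Z^2 + Const q3 * Z^3]"
    using assms by cases auto
  then obtain c0 c1 c2 where
    "h = (\<lambda>p. c0 + c1 * eval p (X + p2 + p3) + c2 * eval p (Y + Const q2 * Z^2 + Const q3 * Z^3))"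
    using h by (auto simp: pencil_pair)
  then show "\<exists>c. \<forall>p\<in>aff_space 3. \<forall>t. h (move p t (point 1 0 0)) = h p + t * c"
    using f(1,2) by (intro exI[of _ c1]) (auto simp: move_nth eval_move_eq[of _ 1 2] algebra_simps)
qed simp

text \<open>On the line through the origin in direction \<open>v\<close>, the first component has
  the coefficients \<open>v 2 ^ 2\<close> and \<open>v 1 ^ 3\<close> at the powers 2 and 3 of t. The
  second has a power of \<open>v 0\<close> as its nonlinear coefficient. A common direction forces
  all of them to vanish.\<close>

lemma no_common_translation_pencil:
  fixes f :: "'a::alg_closed_field mpoly list"
  assumes "family k f" "k \<in> {8, 9}"
  shows "\<not> common_translation 3 (pencil (length f) (eval_map f))"
proof
  assume "common_translation 3 (pencil (length f) (eval_map f))"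
  then obtain v where v: "v \<in> aff_space 3" "v \<noteq> (\<lambda>_. 0)"
    "\<And>h. h \<in> pencil (length f) (eval_map f) \<Longrightarrow>
      \<exists>c. \<forall>p\<in>aff_space 3. \<forall>t. h (move p t v) = h p + t * c"
    unfolding common_translation_def by blast
  have tr: "\<exists>c. \<forall>x y z t. eval (move (point x y z) t v) (f ! i) = eval (point x y z) (f ! i) + t * c"
    if "i < length f" for i
    using v(3)[OF eval_in_pencil[OF that]] point_in_aff_space by blast
  have "v 0 = 0 \<and> v 1 = 0 \<and> v 2 = 0"
    using assms(1)
  proof cases
    case fam8
    have two: "(2 :: 'a) = 0" using of_nat_CHAR[where 'a = 'a] fam8 by simp
    obtain c d where
      c: "\<And>x y z t. eval (move (point x y z) t v) (X + Z^2 + Y^3) = eval (point x y z) (X + Z^2 + Y^3) + t * c"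
      and d: "\<And>x y z t. eval (move (point x y z) t v) (Y + X^2) = eval (point x y z) (Y + X^2) + t * d"
      using tr[of 0] tr[of 1] fam8 by auto
    have "0 + (v 0 - c) * t + v 2 ^ 2 * t ^ 2 + v 1 ^ 3 * t ^ 3 = 0" for t
      using c[of 0 0 0 t] by (simp add: move_nth algebra_simps)
    from cubic_identity_zero[OF this] have "v 1 = 0" "v 2 = 0" by simp_all
    have "0 + (v 1 - d) * t + v 0 ^ 2 * t ^ 2 + 0 * t ^ 3 = 0" for t
      using d[of 0 0 0 t] by (simp add: move_nth algebra_simps)
    from cubic_identity_zero(3)[OF this] \<open>v 1 = 0\<close> \<open>v 2 = 0\<close> show ?thesis by simp
  next
    case fam9
    obtain c d where
      c: "\<And>x y z t. eval (move (point x y z) t v) (X + Z^2 + Y^3) = eval (point x y z) (X + Z^2 + Y^3) + t * c"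
      and d: "\<And>x y z t. eval (move (point x y z) t v) (Z + X^3) = eval (point x y z) (Z + X^3) + t * d"
      using tr[of 0] tr[of 1] fam9 by auto
    have "0 + (v 0 - c) * t + v 2 ^ 2 * t ^ 2 + v 1 ^ 3 * t ^ 3 = 0" for t
      using c[of 0 0 0 t] by (simp add: move_nth algebra_simps)
    from cubic_identity_zero[OF this] have "v 1 = 0" "v 2 = 0" by simp_all
    have "0 + (v 2 - d) * t + 0 * t ^ 2 + v 0 ^ 3 * t ^ 3 = 0" for t
      using d[of 0 0 0 t] by (simp add: move_nth algebra_simps)
    from cubic_identity_zero(4)[OF this] \<open>v 1 = 0\<close> \<open>v 2 = 0\<close> show ?thesis by simp
  qed (use assms(2) in auto)
  then show False using v(1,2) aff_space_3_eq_zero by blast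
qed

section \<open>Separation of the eleven families\<close>

text \<open>Equivalent systems have the same number of components, so comparisons stay within the
  blocks 1 to 3, 4 to 9 and 10 to 11.\<close>

lemma family_length:
  assumes "family k f"
  shows "length f = (if k \<le> 3 then 1 else if k \<le> 9 then 2 else 3)"
  using assms by cases simp_all

theorem proposition3p9p4:
  fixes f g :: "'a::alg_closed_field mpoly list" and n k l :: nat
  assumes "k \<in> {1..11}" and "l \<in> {1..11}"
    and "affine_linear_system 3 n f" and "affine_linear_system 3 n g"
    and "family k f" and "family l g"
    and "equivalent_systems 3 n f g"
  shows "k = l"
proof -
  have m: "morphism 3 n f" "morphism 3 n g"
    using assms(3,4) by (simp_all add: affine_linear_system_def)
  then have len: "length f = n" "length g = n" by (simp_all add: morphism_def)
  have fg: "equivalent_maps 3 n (eval_map f) (eval_map g)"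
    by (rule equivalent_systems_equivalent_maps) (use m assms(7) in auto)
  \<comment> \<open>The transfer lemmas are one-way implications; with both \<open>fg\<close> and
    \<open>gf\<close> they become the equivalences \<open>I1\<close> to \<open>I4\<close>.\<close>
  have gf: "equivalent_maps 3 n (eval_map g) (eval_map f)"
    by (rule equivalent_maps_sym[OF fg])
  let ?F = "pencil n (eval_map f)" and ?G = "pencil n (eval_map g)"
  have I1: "(\<forall>h\<in>?F. coordinate_like 3 h) \<longleftrightarrow> (\<forall>h\<in>?G. coordinate_like 3 h)"
    using coordinate_like_transfer[OF fg] coordinate_like_transfer[OF gf] by blast
  have I2: "(\<forall>h\<in>?F. affine_slope 3 h) \<longleftrightarrow> (\<forall>h\<in>?G. affine_slope 3 h)"
    using affine_slope_transfer[OF fg] affine_slope_transfer[OF gf] by blast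
  have I3: "(\<exists>h\<in>?F. \<exists>l. affine_functional 3 h l) \<longleftrightarrow> (\<exists>h\<in>?G. \<exists>l. affine_functional 3 h l)"
    using affine_member_transfer[OF fg] affine_member_transfer[OF gf] by blast
  have I4: "common_translation 3 ?F \<longleftrightarrow> common_translation 3 ?G"
    using common_translation_transfer[OF fg] common_translation_transfer[OF gf] by blast
  have "(k \<le> 3 \<longleftrightarrow> l \<le> 3) \<and> (k \<le> 9 \<longleftrightarrow> l \<le> 9)"
    using family_length[OF assms(5)] family_length[OF assms(6)] unfolding len by presburger
  moreover have "k \<in> {1, 4, 8, 9, 10} \<longleftrightarrow> l \<in> {1, 4, 8, 9, 10}"
    using I1 coordinate_like_pencil_iff[OF assms(5)] coordinate_like_pencil_iff[OF assms(6)]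
    unfolding len by argo
  moreover have "\<not> (k \<in> {2, 6} \<and> l \<in> {3, 7})" "\<not> (l \<in> {2, 6} \<and> k \<in> {3, 7})"
    using I2 affine_slope_pencil[OF assms(5)] affine_slope_pencil[OF assms(6)]
      not_affine_slope_pencil[OF assms(5)] not_affine_slope_pencil[OF assms(6)]
    unfolding len by metis+
  moreover have "\<not> (k \<in> {6, 7} \<and> l = 5)" "\<not> (l \<in> {6, 7} \<and> k = 5)"
    using I3 affine_member_pencil[OF assms(5)] affine_member_pencil[OF assms(6)]
      no_affine_member_pencil[of f] no_affine_member_pencil[of g] assms(5,6)
    unfolding len by metis+
  moreover have "\<not> (k = 4 \<and> l \<in> {8, 9})" "\<not> (l = 4 \<and> k \<in> {8, 9})"
    using I4 common_translation_pencil[of f] common_translation_pencil[of g]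
      no_common_translation_pencil[OF assms(5)] no_common_translation_pencil[OF assms(6)] assms(5,6)
    unfolding len by metis+
  \<comment> \<open>The component count and the four invariants leave only the pair 8 and 9, which
    the characteristic separates.\<close>
  moreover have "k = 8 \<Longrightarrow> CHAR('a) = 2" "k = 9 \<Longrightarrow> CHAR('a) = 3"
    using assms(5) by (auto elim: family.cases)
  moreover have "l = 8 \<Longrightarrow> CHAR('a) = 2" "l = 9 \<Longrightarrow> CHAR('a) = 3"
    using assms(6) by (auto elim: family.cases)
  ultimately show ?thesis
    using assms(1,2) by (auto simp: eval_nat_numeral le_Suc_eq)
qed

end
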